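(* Let $\varphi,\psi:\mathbb{R}\to\mathbb{R}$ satisfy the standing hypotheses given in the context. For every choice of $X_0$ and $X_1$ in $\mathbb{R}^2\times S^1\times\mathbb{R}$ there exist $\bar T>0$ and a control $\bar u:[0,\bar T]\to\mathbb{R}$, with corresponding trajectory $\bar X(\cdot)$ of the control system $\dot x=\cos\theta,\ \dot y=\sin\theta,\ \dot\theta=\kappa,\ \dot\kappa=u$ satisfying $\bar X(0)=X_0$ and $\bar X(\bar T)=X_1$, which minimizes the cost $\mathcal{C}(u(\cdot))=\int_0^T[1+\varphi(\kappa(t))+\psi(u(t))]\,dt$ among all trajectories of the system starting from $X_0$ and reaching $X_1$ (the final time $T$ being free).
   Context: Standing hypotheses on the cost: (1) $\varphi$ and $\psi$ are nonnegative, even, $C^2$ functions on $\mathbb{R}$, nondecreasing on $[0,\infty)$, with $\varphi(0)=\psi(0)=0$; (2) $\psi$ is strictly convex and $\psi''(0)>0$; (3) there exist $p>1$ and constants $C,R>0$ such that $\psi(r)\ge C|r|^p$ for all $|r|\ge R$. Control system: the state is $X=(x,y,\theta,\kappa)\in\mathbb{R}^2\times S^1\times\mathbb{R}$, with $S^1=\mathbb{R}/2\pi\mathbb{Z}$. A control is a measurable function $u:[0,T]\to\mathbb{R}$ with finite $L^p$ norm, where $T>0$ depends on $u$; the trajectory of $u$ is the absolutely continuous solution of $\dot x=\cos\theta,\ \dot y=\sin\theta,\ \dot\theta=\kappa,\ \dot\kappa=u$ on $[0,T]$. *)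

theory Defs
  imports "HOL-Analysis.Analysis"
begin

definition C2_fun :: "(real \<Rightarrow> real) \<Rightarrow> bool" where
  "C2_fun f \<longleftrightarrow> (\<forall>r. f differentiable at r) \<and> (\<forall>r. deriv f differentiable at r)
     \<and> continuous_on UNIV (deriv (deriv f))"

definition strictly_convex :: "(real \<Rightarrow> real) \<Rightarrow> bool" where
  "strictly_convex f \<longleftrightarrow>
     (\<forall>r s t. r \<noteq> s \<longrightarrow> 0 < t \<longrightarrow> t < 1 \<longrightarrow>
        f ((1 - t) * r + t * s) < (1 - t) * f r + t * f s)"

text \<open>
  The usual \<open>\<epsilon>\<close>-\<open>\<delta>\<close> absolute continuity on \<open>[l, r]\<close>. Degenerate intervals (\<open>a k = b k\<close>) and
  common endpoints are permitted; neither affects the notion.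
\<close>

definition absolutely_cont :: "real \<Rightarrow> real \<Rightarrow> (real \<Rightarrow> real) \<Rightarrow> bool" where
  "absolutely_cont l r f \<longleftrightarrow>
     (\<forall>\<epsilon>>0. \<exists>\<delta>>0. \<forall>(n::nat) a b.
        (\<forall>k<n. l \<le> a k \<and> a k \<le> b k \<and> b k \<le> r) \<longrightarrow>
        disjoint_family_on (\<lambda>k. {a k<..<b k}) {..<n} \<longrightarrow>
        (\<Sum>k<n. b k - a k) < \<delta> \<longrightarrow>
        (\<Sum>k<n. \<bar>f (b k) - f (a k)\<bar>) < \<epsilon>)"

quotient_type circle = real / "\<lambda>a b::real. \<exists>k::int. a - b = 2 * pi * of_int k"
  morphisms rep_circle proj_circle
proof (rule equivpI)
  show "reflp (\<lambda>a b::real. \<exists>k::int. a - b = 2 * pi * of_int k)"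
    by (rule reflpI) (simp add: exI[of _ 0])
  show "symp (\<lambda>a b::real. \<exists>k::int. a - b = 2 * pi * of_int k)"
  proof (rule sympI)
    fix a b :: real
    assume "\<exists>k::int. a - b = 2 * pi * of_int k"
    then obtain k :: int where "a - b = 2 * pi * of_int k" by blast
    then have "b - a = 2 * pi * of_int (- k)" by simp
    then show "\<exists>k::int. b - a = 2 * pi * of_int k" by blast
  qed
  show "transp (\<lambda>a b::real. \<exists>k::int. a - b = 2 * pi * of_int k)"
  proof (rule transpI)
    fix a b c :: real
    assume "\<exists>k::int. a - b = 2 * pi * of_int k" and "\<exists>k::int. b - c = 2 * pi * of_int k"
    then obtain j k :: int where "a - b = 2 * pi * of_int j" "b - c = 2 * pi * of_int k"
      by blast
    then have "a - c = 2 * pi * of_int (j + k)" by (simp add: algebra_simps)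
    then show "\<exists>k::int. a - c = 2 * pi * of_int k" by blast
  qed
qed

type_synonym state = "real \<times> real \<times> circle \<times> real"

definition curvature :: "state \<Rightarrow> real" where
  "curvature X = snd (snd (snd X))"

text \<open>Controls and trajectories are total functions whose values outside \<open>[0, T]\<close> are irrelevant.\<close>

definition control :: "real \<Rightarrow> real \<Rightarrow> (real \<Rightarrow> real) \<Rightarrow> bool" where
  "control p T u \<longleftrightarrow> T > 0 \<and> u \<in> borel_measurable (lebesgue_on {0..T})
     \<and> integrable (lebesgue_on {0..T}) (\<lambda>t. \<bar>u t\<bar> powr p)"

text \<open>
  A curve in the circle is absolutely continuous with velocity \<open>\<kappa>\<close> iff it has an absolutely
  continuous lift \<open>\<theta>\<close> to the reals with derivative \<open>\<kappa>\<close>; \<open>cos\<close> and \<open>sin\<close> may be evaluated on any lift.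
\<close>

definition trajectory :: "real \<Rightarrow> (real \<Rightarrow> real) \<Rightarrow> (real \<Rightarrow> state) \<Rightarrow> bool" where
  "trajectory T u X \<longleftrightarrow>
     (\<exists>x y \<theta> \<kappa>.
        (\<forall>t\<in>{0..T}. X t = (x t, y t, proj_circle (\<theta> t), \<kappa> t)) \<and>
        absolutely_cont 0 T x \<and> absolutely_cont 0 T y \<and>
        absolutely_cont 0 T \<theta> \<and> absolutely_cont 0 T \<kappa> \<and>
        (AE t in lebesgue_on {0..T}.
           (x has_real_derivative cos (\<theta> t)) (at t within {0..T}) \<and>
           (y has_real_derivative sin (\<theta> t)) (at t within {0..T}) \<and>
           (\<theta> has_real_derivative \<kappa> t) (at t within {0..T}) \<and>
           (\<kappa> has_real_derivative u t) (at t within {0..T})))"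

definition admissible ::
  "real \<Rightarrow> state \<Rightarrow> state \<Rightarrow> real \<Rightarrow> (real \<Rightarrow> real) \<Rightarrow> (real \<Rightarrow> state) \<Rightarrow> bool" where
  "admissible p X0 X1 T u X \<longleftrightarrow>
     control p T u \<and> trajectory T u X \<and> X 0 = X0 \<and> X T = X1"

text \<open>
  The integral is taken in \<open>[0, \<infinity>]\<close>: the integrand is nonnegative, but \<open>\<psi> \<circ> u\<close> need not be integrable
  for a control \<open>u\<close> that is merely in \<open>L\<^sup>p\<close>.
\<close>

definition cost ::
  "(real \<Rightarrow> real) \<Rightarrow> (real \<Rightarrow> real) \<Rightarrow> real \<Rightarrow> (real \<Rightarrow> real) \<Rightarrow> (real \<Rightarrow> state) \<Rightarrow> ennreal" where
  "cost \<phi> \<psi> T u X =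
     (\<integral>\<^sup>+ t. ennreal (1 + \<phi> (curvature (X t)) + \<psi> (u t)) \<partial>lebesgue_on {0..T})"

end

theory Submission
  imports Defs "HOL-Complex_Analysis.Great_Picard"
begin

text \<open>
  The direct method, with the curvature \<open>\<kappa>\<close> rather than the control \<open>u\<close> as the unknown. Along a
  minimizing sequence the superlinear growth of \<open>\<psi>\<close> makes the controls uniformly integrable, so the
  curvatures are equicontinuous and converge uniformly along a subsequence, and the limit is
  absolutely continuous. Weak compactness in \<open>L\<^sup>p\<close> is avoided: by Jensen's inequality,
  \<open>\<integral> \<psi> ((\<kappa> (t + h) - \<kappa> t) / h) dt \<le> \<integral> \<psi> (u t) dt\<close>, and the left-hand side passes to the limit by Fatou's
  lemma, first along the sequence and then as \<open>h\<close> tends to \<open>0\<close>. The final times stay away from \<open>0\<close>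
  because a short arc of bounded curvature moves forward by at least half of its length.
\<close>

section \<open>Differentiability of monotone continuous functions\<close>

text \<open>Heading, position and end conditions depend continuously on \<open>\<kappa>\<close>
  under uniform convergence, so only the cost needs semicontinuity. The price is that the limit
  curvature arrives without a control: one has to be found as its derivative, and absolute
  continuity in the \<epsilon>-\<delta> sense does not provide a derivative by itself. This is why
  Lebesgue's theorem on monotone functions is developed here, through comparison of Lebesgue and
  Stieltjes measure on Vitali covers. Conversely, an arbitrary competitor has to be recovered from
  its almost everywhere derivative, which calls for the fundamental theorem for absolutely
  continuous functions.

  The free final time is absorbed by extending controls by 0 past their final time: since \<psi>(0)
  = 0 this costs nothing, and all curvatures live on one common interval. The final times are
  bounded because the running cost is at least 1.\<close>

lemma Vitali_covering_theorem_intervals: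
  fixes K :: "(real \<times> real) set"
  assumes "\<And>a b. (a, b) \<in> K \<Longrightarrow> a < b"
    and "\<And>x d. x \<in> S \<Longrightarrow> 0 < d \<Longrightarrow> \<exists>a b. (a, b) \<in> K \<and> a \<le> x \<and> x \<le> b \<and> b - a < d"
  obtains C where "countable C" "C \<subseteq> K"
    "disjoint_family_on (\<lambda>i. {fst i..snd i}) C"
    "negligible (S - (\<Union>i\<in>C. {fst i..snd i}))"
proof -
  \<comment> \<open>An interval is the closed ball about its midpoint with half its length as
    radius, so the ball version of Vitali's theorem applies.\<close>
  have ball: "cball ((fst i + snd i) / 2) ((snd i - fst i) / 2) = {fst i..snd i}"
    for i :: "real \<times> real"
    unfolding cball_eq_atLeastAtMost by (simp add: field_simps)
  obtain C where C: "countable C" "C \<subseteq> K"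
     "pairwise (\<lambda>i j. disjnt (cball ((fst i + snd i) / 2) ((snd i - fst i) / 2))
        (cball ((fst j + snd j) / 2) ((snd j - fst j) / 2))) C"
     "negligible (S - (\<Union>i\<in>C. cball ((fst i + snd i) / 2) ((snd i - fst i) / 2)))"
  proof (rule Vitali_covering_theorem_cballs[of K "\<lambda>i. (snd i - fst i) / 2" S "\<lambda>i. (fst i + snd i) / 2"])
    show "0 < (snd i - fst i) / 2" if "i \<in> K" for i
      using assms(1)[of "fst i" "snd i"] that by simp
    show "\<exists>i. i \<in> K \<and> x \<in> cball ((fst i + snd i) / 2) ((snd i - fst i) / 2) \<and> (snd i - fst i) / 2 < d"
      if "x \<in> S" "0 < d" for x d
    proof -
      obtain a b where "(a, b) \<in> K" "a \<le> x" "x \<le> b" "b - a < d"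
        using assms(2) \<open>x \<in> S\<close> \<open>0 < d\<close> by blast
      then show ?thesis unfolding ball using assms(1)[of a b] by (intro exI[of _ "(a, b)"]) auto
    qed
  qed
  show thesis
  proof (rule that[OF C(1,2)])
    show "disjoint_family_on (\<lambda>i. {fst i..snd i}) C"
      using C(3) unfolding ball disjoint_family_on_def pairwise_def disjnt_def by blast
    show "negligible (S - (\<Union>i\<in>C. {fst i..snd i}))"
      using C(4) unfolding ball .
  qed
qed

text \<open>Difference quotients over small intervals straddling the point: both sets are
  \<open>G\<^sub>\<delta>\<close> whatever \<open>F\<close> is.\<close>

definition lower_slope_set :: "(real \<Rightarrow> real) \<Rightarrow> real \<Rightarrow> real set" where
  "lower_slope_set F r =
     {x. \<forall>d>0. \<exists>a b. a < x \<and> x < b \<and> b - a < d \<and> F b - F a < r * (b - a)}"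

definition upper_slope_set :: "(real \<Rightarrow> real) \<Rightarrow> real \<Rightarrow> real set" where
  "upper_slope_set F r =
     {x. \<forall>d>0. \<exists>a b. a < x \<and> x < b \<and> b - a < d \<and> F b - F a > r * (b - a)}"

text \<open>For fixed \<open>d\<close> the condition describes a union of open intervals, however
  irregular \<open>Q\<close> is. It weakens as \<open>d\<close> grows, so the values 1/(n+1) suffice
  and a countable intersection of open sets remains.\<close>

lemma straddle_set_borel:
  "{x::real. \<forall>d>0. \<exists>a b. a < x \<and> x < b \<and> b - a < (d::real) \<and> Q a b} \<in> sets borel"
proof -
  have op: "open {x. \<exists>a b. a < x \<and> x < b \<and> b - a < d \<and> Q a b}" for d :: real
  proof -
    have "{x. \<exists>a b. a < x \<and> x < b \<and> b - a < d \<and> Q a b} =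
        (\<Union>i\<in>{i. snd i - fst i < d \<and> Q (fst i) (snd i)}. {fst i<..<snd i})"
      by fastforce
    then show ?thesis by auto
  qed
  have "{x. \<forall>d>0. \<exists>a b. a < x \<and> x < b \<and> b - a < d \<and> Q a b} =
      (\<Inter>n. {x. \<exists>a b. a < x \<and> x < b \<and> b - a < inverse (real (Suc n)) \<and> Q a b})"
    (is "?L = ?R")
  proof
    show "?L \<subseteq> ?R" by (auto simp del: of_nat_Suc)
    show "?R \<subseteq> ?L"
    proof (intro subsetI CollectI allI impI)
      fix x and d :: real assume x: "x \<in> ?R" and "d > 0"
      then obtain n where "inverse (real (Suc n)) < d" using reals_Archimedean by blast
      moreover obtain a b where "a < x" "x < b" "b - a < inverse (real (Suc n))" "Q a b"
        using x by blast
      ultimately show "\<exists>a b. a < x \<and> x < b \<and> b - a < d \<and> Q a b" by fastforce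
    qed
  qed
  moreover have "?R \<in> sets borel" using op by (intro sets.countable_INT') (auto simp del: of_nat_Suc)
  ultimately show ?thesis by simp
qed

lemma lower_slope_set_borel [measurable]: "lower_slope_set F r \<in> sets borel"
  unfolding lower_slope_set_def by (rule straddle_set_borel)

lemma upper_slope_set_borel [measurable]: "upper_slope_set F r \<in> sets borel"
  unfolding upper_slope_set_def by (rule straddle_set_borel)

lemma upper_slope_set_antimono:
  assumes "c \<le> c'"
  shows "upper_slope_set F c' \<subseteq> upper_slope_set F c"
  unfolding upper_slope_set_def
proof (intro subsetI CollectI allI impI)
  fix x d :: real
  assume "x \<in> {x. \<forall>d>0. \<exists>a b. a < x \<and> x < b \<and> b - a < d \<and> c' * (b - a) < F b - F a}" "d > 0"
  then obtain a b where ab: "a < x" "x < b" "b - a < d" "c' * (b - a) < F b - F a" by blast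
  moreover have "c * (b - a) \<le> c' * (b - a)" using assms ab by (intro mult_right_mono) auto
  ultimately show "\<exists>a b. a < x \<and> x < b \<and> b - a < d \<and> c * (b - a) < F b - F a"
    by (meson le_less_trans)
qed

text \<open>This adds up a comparison of two measures over a disjoint Vitali family; it is applied
  to Lebesgue and Stieltjes measure in either order.\<close>

lemma emeasure_UN_le_mult:
  assumes "countable C" "disjoint_family_on A C"
    and "\<And>i. i \<in> C \<Longrightarrow> A i \<in> sets M" "sets N = sets M"
    and "\<And>i. i \<in> C \<Longrightarrow> emeasure M (A i) \<le> c * emeasure N (A i)"
  shows "emeasure M (\<Union>i\<in>C. A i) \<le> c * emeasure N (\<Union>i\<in>C. A i)"
proof -
  have "emeasure M (\<Union>i\<in>C. A i) = (\<integral>\<^sup>+i. emeasure M (A i) \<partial>count_space C)"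
    using assms by (intro emeasure_UN_countable) auto
  also have "\<dots> \<le> (\<integral>\<^sup>+i. c * emeasure N (A i) \<partial>count_space C)"
    using assms by (intro nn_integral_mono) auto
  also have "\<dots> = c * (\<integral>\<^sup>+i. emeasure N (A i) \<partial>count_space C)"
    by (intro nn_integral_cmult) auto
  also have "(\<integral>\<^sup>+i. emeasure N (A i) \<partial>count_space C) = emeasure N (\<Union>i\<in>C. A i)"
    using assms by (intro emeasure_UN_countable[symmetric]) auto
  finally show ?thesis .
qed

lemma emeasure_lborel_le_negligible_diff:
  fixes S A :: "real set"
  assumes "S \<in> sets borel" "A \<in> sets borel" "negligible (S - A)"
  shows "emeasure lborel S \<le> emeasure lborel A"
proof -
  have "emeasure lborel (S - A) = 0"
    using assms negligible_iff_emeasure0[of "S - A"] by (simp add: sets.Diff)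
  moreover have "emeasure lborel S \<le> emeasure lborel (A \<union> (S - A))"
    using assms by (intro emeasure_mono) auto
  moreover have "emeasure lborel (A \<union> (S - A)) \<le> emeasure lborel A + emeasure lborel (S - A)"
    using assms by (intro emeasure_subadditive) auto
  ultimately show ?thesis by simp
qed

context
  fixes F :: "real \<Rightarrow> real"
  assumes mono: "mono F" and cont: "continuous_on UNIV F"
begin

private lemma emeasure_Icc: "a \<le> b \<Longrightarrow> emeasure (interval_measure F) {a..b} = ennreal (F b - F a)"
  using mono cont
  by (intro emeasure_interval_measure_Icc)
     (auto simp: mono_def continuous_on_eq_continuous_within intro: continuous_within_subset)

text \<open>Intervals inside \<open>W\<close> on which \<open>F\<close> rises by more than
  \<open>c\<close> times the length form a Vitali cover of \<open>S\<close>. A disjoint subfamily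
  covers almost all of \<open>S\<close>, and its Stieltjes mass, the sum of the increments, fits
  into \<open>W\<close>.\<close>

lemma Stieltjes_ge_upper_slope:
  assumes S: "S \<in> sets borel" "S \<subseteq> upper_slope_set F c" "S \<subseteq> W" and W: "open W" and c: "0 \<le> c"
  shows "ennreal c * emeasure lborel S \<le> emeasure (interval_measure F) W"
proof (cases "c = 0")
  case False
  with c have c: "c > 0" by simp
  define K where "K = {(a, b). a < b \<and> {a..b} \<subseteq> W \<and> F b - F a > c * (b - a)}"
  obtain C where C: "countable C" "C \<subseteq> K" "disjoint_family_on (\<lambda>i. {fst i..snd i}) C"
    "negligible (S - (\<Union>i\<in>C. {fst i..snd i}))"
  proof (rule Vitali_covering_theorem_intervals[of K S])
    show "a < b" if "(a, b) \<in> K" for a b using that by (simp add: K_def)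
    show "\<exists>a b. (a, b) \<in> K \<and> a \<le> x \<and> x \<le> b \<and> b - a < d" if "x \<in> S" "0 < d" for x d
    proof -
      obtain e where e: "e > 0" "ball x e \<subseteq> W"
        using W S \<open>x \<in> S\<close> by (meson openE subsetD)
      have "x \<in> upper_slope_set F c" "0 < min d e" using S(2) \<open>x \<in> S\<close> e \<open>0 < d\<close> by auto
      then obtain a b where ab: "a < x" "x < b" "b - a < min d e" "F b - F a > c * (b - a)"
        unfolding upper_slope_set_def by blast
      have "{a..b} \<subseteq> ball x e" using ab by (auto simp: dist_real_def)
      then have "(a, b) \<in> K" using ab e by (auto simp: K_def)
      then show ?thesis using ab by (intro exI[of _ a] exI[of _ b]) auto
    qed
  qed
  let ?A = "\<Union>i\<in>C. {fst i..snd i}"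
  have A: "?A \<in> sets borel" using C(1) by (intro sets.countable_UN') auto
  have "emeasure lborel ?A \<le> ennreal (1 / c) * emeasure (interval_measure F) ?A"
  proof (rule emeasure_UN_le_mult[OF C(1,3)])
    fix i assume "i \<in> C"
    then have i: "fst i < snd i" "F (snd i) - F (fst i) > c * (snd i - fst i)"
      using C(2) by (auto simp: K_def)
    then have "snd i - fst i \<le> 1 / c * (F (snd i) - F (fst i))" using c by (simp add: field_simps)
    then show "emeasure lborel {fst i..snd i} \<le> ennreal (1 / c) * emeasure (interval_measure F) {fst i..snd i}"
      using i c emeasure_Icc[of "fst i" "snd i"]
      by (simp add: ennreal_mult'[symmetric] ennreal_leI)
  qed auto
  with c have "ennreal c * emeasure lborel ?A \<le> ennreal c * (ennreal (1 / c) * emeasure (interval_measure F) ?A)"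
    by (intro mult_left_mono) auto
  also have "\<dots> = emeasure (interval_measure F) ?A"
    using c by (simp add: mult.assoc[symmetric] ennreal_mult'[symmetric])
  also have "\<dots> \<le> emeasure (interval_measure F) W"
    using C(2) W by (intro emeasure_mono) (fastforce simp: K_def, simp)
  finally have "ennreal c * emeasure lborel ?A \<le> emeasure (interval_measure F) W" .
  moreover have "ennreal c * emeasure lborel S \<le> ennreal c * emeasure lborel ?A"
    using emeasure_lborel_le_negligible_diff[OF S(1) A C(4)] by (intro mult_left_mono) auto
  ultimately show ?thesis by (rule order_trans[rotated])
qed simp

text \<open>The two slope bounds compete on the same set. Disjoint intervals of slope below
  \<open>r\<close> inside an open set hardly larger than \<open>S\<close> have Stieltjes mass at
  most about r|S|, while the upper slope estimate on those same intervals gives at least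
  c|S|.\<close>

lemma slope_gap_null:
  assumes S: "S \<in> sets borel" "bounded S" "S \<subseteq> lower_slope_set F r" "S \<subseteq> upper_slope_set F c"
    and rc: "0 < r" "r < c"
  shows "emeasure lborel S = 0"
proof -
  have fin: "emeasure lborel S < \<infinity>" using S(2) emeasure_bounded_finite by blast
  have bound: "ennreal c * emeasure lborel S \<le> ennreal r * (emeasure lborel S + ennreal e)"
    if "e > 0" for e
  proof -
    obtain W0 where W0: "open W0" "S \<subseteq> W0" "emeasure lborel (W0 - S) < ennreal e"
      using outer_regular_lborel[of S e] S(1) \<open>e > 0\<close> by (metis sets_lborel)
    have W0_le: "emeasure lborel W0 \<le> emeasure lborel S + ennreal e"
    proof -
      have "emeasure lborel W0 \<le> emeasure lborel (S \<union> (W0 - S))"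
        using W0 S by (intro emeasure_mono) auto
      also have "\<dots> \<le> emeasure lborel S + emeasure lborel (W0 - S)"
        using W0 S by (intro emeasure_subadditive) auto
      finally show ?thesis using W0(3) by (meson add_left_mono less_imp_le order_trans)
    qed
    define K where "K = {(a, b). a < b \<and> {a..b} \<subseteq> W0 \<and> F b - F a < r * (b - a)}"
    obtain C where C: "countable C" "C \<subseteq> K" "disjoint_family_on (\<lambda>i. {fst i..snd i}) C"
      "negligible (S - (\<Union>i\<in>C. {fst i..snd i}))"
    proof (rule Vitali_covering_theorem_intervals[of K S])
      show "a < b" if "(a, b) \<in> K" for a b using that by (simp add: K_def)
      show "\<exists>a b. (a, b) \<in> K \<and> a \<le> x \<and> x \<le> b \<and> b - a < d" if "x \<in> S" "0 < d" for x d
      proof -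
        obtain e' where e: "e' > 0" "ball x e' \<subseteq> W0"
          using W0 \<open>x \<in> S\<close> by (meson openE subsetD)
        have "x \<in> lower_slope_set F r" "0 < min d e'" using S(3) \<open>x \<in> S\<close> e \<open>0 < d\<close> by auto
        then obtain a b where ab: "a < x" "x < b" "b - a < min d e'" "F b - F a < r * (b - a)"
          unfolding lower_slope_set_def by blast
        have "{a..b} \<subseteq> ball x e'" using ab by (auto simp: dist_real_def)
        then have "(a, b) \<in> K" using ab e by (auto simp: K_def)
        then show ?thesis using ab by (intro exI[of _ a] exI[of _ b]) auto
      qed
    qed
    let ?A = "\<Union>i\<in>C. {fst i..snd i}" and ?W = "\<Union>i\<in>C. {fst i<..<snd i}"
    have A: "?A \<in> sets borel" using C(1) by (intro sets.countable_UN') auto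
    have W: "open ?W" by auto
    \<comment> \<open>The upper slope estimate needs an open set around the points, so the closed
      cells are replaced by their interiors; only countably many endpoints are lost.\<close>
    have neg: "negligible (S - ?W)"
    proof (rule negligible_subset)
      have "countable (fst ` C \<union> snd ` C)" using C(1) by simp
      then have "negligible (fst ` C \<union> snd ` C)" using countable_imp_null_set_lborel negligible_iff_null_sets null_sets_completionI by blast
      with C(4) show "negligible ((S - ?A) \<union> (fst ` C \<union> snd ` C))" by (rule negligible_Un)
      show "S - ?W \<subseteq> (S - ?A) \<union> (fst ` C \<union> snd ` C)"
      proof
        fix x assume "x \<in> S - ?W"
        then show "x \<in> (S - ?A) \<union> (fst ` C \<union> snd ` C)"
          by (cases "x \<in> ?A") (force simp: order_le_less)+
      qed
    qed
    have "emeasure lborel S \<le> emeasure lborel (S \<inter> ?W)"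
      using neg S(1) W by (intro emeasure_lborel_le_negligible_diff) (auto simp: Diff_Int)
    then have "ennreal c * emeasure lborel S \<le> ennreal c * emeasure lborel (S \<inter> ?W)"
      by (intro mult_left_mono) auto
    also have "\<dots> \<le> emeasure (interval_measure F) ?W"
      using S W rc by (intro Stieltjes_ge_upper_slope) auto
    also have "\<dots> \<le> emeasure (interval_measure F) ?A"
      using A by (intro emeasure_mono) (fastforce, simp)
    also have "\<dots> \<le> ennreal r * emeasure lborel ?A"
    proof (rule emeasure_UN_le_mult[OF C(1,3)])
      fix i assume "i \<in> C"
      then have i: "fst i < snd i" "F (snd i) - F (fst i) < r * (snd i - fst i)"
        using C(2) by (auto simp: K_def)
      then show "emeasure (interval_measure F) {fst i..snd i} \<le> ennreal r * emeasure lborel {fst i..snd i}"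
        using rc emeasure_Icc[of "fst i" "snd i"]
        by (simp add: ennreal_mult'[symmetric] ennreal_leI)
    qed auto
    also have "\<dots> \<le> ennreal r * emeasure lborel W0"
      using C(2) W0 by (intro mult_left_mono emeasure_mono) (fastforce simp: K_def, simp_all)
    also have "\<dots> \<le> ennreal r * (emeasure lborel S + ennreal e)"
      using W0_le by (intro mult_left_mono) auto
    finally show ?thesis .
  qed
  \<comment> \<open>Boundedness of \<open>S\<close> makes its measure a real number
    \<open>s\<close>; then c * s \<le> r * (s + e) for all e > 0 with r < c leaves only s =
    0.\<close>
  obtain s where s: "emeasure lborel S = ennreal s" "s \<ge> 0"
    using fin by (cases "emeasure lborel S") auto
  have "c * s \<le> r * (s + e)" if "e > 0" for e
    using bound[OF that] s rc that
    by (simp add: ennreal_mult'[symmetric] ennreal_plus[symmetric] ennreal_le_iff del: ennreal_plus)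
  then have "(c - r) / r * s \<le> e" if "e > 0" for e
    using that rc by (simp add: field_simps)
  then have "(c - r) / r * s \<le> 0" by (rule field_le_epsilon[of _ 0, simplified])
  with rc s have "s = 0" by (simp add: mult_le_0_iff divide_le_0_iff)
  with s show ?thesis by simp
qed

text \<open>The Stieltjes mass of the window is the finite number F(N) - F(-N), and it dominates
  \<open>n\<close> times the measure of the set for every \<open>n\<close>.\<close>

lemma infinite_slope_null:
  "emeasure lborel ((\<Inter>n. upper_slope_set F (real n)) \<inter> {-real N<..<real N}) = 0"
    (is "emeasure lborel ?S = 0")
proof -
  have S: "?S \<in> sets borel" by measurable
  have "emeasure lborel ?S < \<infinity>"
    using emeasure_bounded_finite[of ?S] by (simp add: bounded_Int)
  then obtain s where s: "emeasure lborel ?S = ennreal s" "s \<ge> 0"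
    by (cases "emeasure lborel ?S") auto
  have "real n * s \<le> F N - F (- real N)" for n
  proof -
    have "ennreal (real n) * emeasure lborel ?S \<le> emeasure (interval_measure F) {-real N<..<real N}"
      using S by (intro Stieltjes_ge_upper_slope) auto
    also have "\<dots> \<le> emeasure (interval_measure F) {-real N..real N}"
      by (intro emeasure_mono) auto
    finally show ?thesis
      using s mono by (simp add: emeasure_Icc ennreal_mult'[symmetric] ennreal_le_iff monoD del: ennreal_of_nat_eq_real_of_nat)
  qed
  then have "\<not> s > 0" by (metis ex_less_of_nat_mult not_le)
  with s show ?thesis by simp
qed

text \<open>Outside a null set no pair of rationals separates the small slopes at \<open>x\<close>
  from the large ones, and the slopes are bounded near \<open>x\<close>. The slopes over shrinking
  intervals around \<open>x\<close> then have one finite limit.\<close>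

lemma mono_continuous_differentiable_AE:
  "AE x in lborel. F differentiable at x"
proof -
  let ?gap = "\<lambda>r c. lower_slope_set F r \<inter> upper_slope_set F c"
  have gap: "AE x in lborel. x \<notin> ?gap r c" if "0 < r" "r < c" for r c
  proof -
    have "emeasure lborel (?gap r c \<inter> {- real N<..<real N}) = 0" for N :: nat
      using that by (intro slope_gap_null[of _ r c]) (auto simp: bounded_Int)
    then have "AE x in lborel. x \<notin> ?gap r c \<inter> {- real N<..<real N}" for N :: nat
      by (intro AE_not_in) (auto simp: null_sets_def)
    then have "AE x in lborel. \<forall>N::nat. x \<notin> ?gap r c \<inter> {- real N<..<real N}"
      by (simp only: AE_all_countable) blast
    then show ?thesis
    proof eventually_elim
      case (elim x)
      obtain N :: nat where "\<bar>x\<bar> < N" using reals_Archimedean2 by blast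
      with elim show ?case by (auto simp: abs_less_iff dest: spec[of _ N])
    qed
  qed
  have "AE x in lborel. \<forall>r\<in>\<rat>. \<forall>c\<in>\<rat>. 0 < r \<and> r < c \<longrightarrow> x \<notin> ?gap r c"
    using gap by (auto simp: AE_ball_countable countable_rat)
  moreover have "AE x in lborel. \<forall>N::nat. x \<notin> (\<Inter>n. upper_slope_set F (real n)) \<inter> {-real N<..<real N}"
    unfolding AE_all_countable using infinite_slope_null
    by (intro allI AE_not_in) (auto simp: null_sets_def)
  ultimately show ?thesis
  proof eventually_elim
    case (elim x)
    obtain N :: nat where "\<bar>x\<bar> < N" using reals_Archimedean2 by blast
    with elim(2) obtain n0 :: nat where n0: "x \<notin> upper_slope_set F (real n0)"
      by (auto simp: abs_less_iff dest: spec[of _ N])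
    have F_mono: "F a \<le> F b" if "a \<le> b" for a b using mono that by (simp add: mono_def)
    \<comment> \<open>\<open>Z\<close> is an up-set of numbers that eventually bound the slopes
      around \<open>x\<close> from above, so its infimum \<open>l\<close> is the upper derivative,
      the only candidate for the derivative.\<close>
    define Z where "Z = {c. 0 < c \<and> x \<notin> upper_slope_set F c}"
    have up: "c' \<in> Z" if "c \<in> Z" "c \<le> c'" for c c'
      using that upper_slope_set_antimono[of c c' F] by (auto simp: Z_def)
    have "real n0 + 1 \<in> Z"
      using n0 upper_slope_set_antimono[of "real n0" "real n0 + 1" F] by (auto simp: Z_def)
    then have Z: "Z \<noteq> {}" by auto
    have bdd: "bdd_below Z" by (rule bdd_belowI[of _ 0]) (simp add: Z_def)
    define l where "l = Inf Z"
    have l0: "0 \<le> l" unfolding l_def using Z by (intro cInf_greatest) (auto simp: Z_def)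
    have upper: "\<exists>d>0. \<forall>a b. a < x \<and> x < b \<and> b - a < d \<longrightarrow> F b - F a \<le> (l + e) * (b - a)"
      if "e > 0" for e
    proof -
      obtain c where "c \<in> Z" "c < l + e"
        using cInf_lessD[OF Z, of "l + e"] \<open>e > 0\<close> unfolding l_def by auto
      then have "l + e \<in> Z" using up by force
      then have "\<not> (\<forall>d>0. \<exists>a b. a < x \<and> x < b \<and> b - a < d \<and> F b - F a > (l + e) * (b - a))"
        by (simp add: Z_def upper_slope_set_def)
      then show ?thesis by (meson not_le)
    qed
    have lower: "\<exists>d>0. \<forall>a b. a < x \<and> x < b \<and> b - a < d \<longrightarrow> F b - F a \<ge> (l - e) * (b - a)"
      if "e > 0" for e
    proof (cases "l - e \<le> 0")
      case True
      show ?thesis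
      proof (intro exI[of _ 1] conjI allI impI)
        fix a b assume "a < x \<and> x < b \<and> b - a < 1"
        moreover from this True have "(l - e) * (b - a) \<le> 0" by (intro mult_nonpos_nonneg) auto
        ultimately show "F b - F a \<ge> (l - e) * (b - a)" using F_mono[of a b] by linarith
      qed simp
    next
      case False
      \<comment> \<open>Two rationals are needed below \<open>l\<close>: slopes above
        \<open>c\<close> occur arbitrarily close to \<open>x\<close> because \<open>c\<close> lies
        below the infimum, and the gap property with r < c then excludes slopes below
        \<open>r\<close> on small intervals.\<close>
      obtain r where r: "r \<in> \<rat>" "l - e < r" "r < l" using Rats_dense_in_real[of "l - e" l] \<open>e > 0\<close> by auto
      obtain c where c: "c \<in> \<rat>" "r < c" "c < l" using Rats_dense_in_real[of r l] r by auto
      have "c \<notin> Z" using c bdd cInf_lower[of c Z] by (auto simp: l_def)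
      then have "x \<in> upper_slope_set F c" using False r c by (auto simp: Z_def)
      then have "x \<notin> lower_slope_set F r" using elim(1) r c False by auto
      then have "\<not> (\<forall>d>0. \<exists>a b. a < x \<and> x < b \<and> b - a < d \<and> F b - F a < r * (b - a))"
        by (simp add: lower_slope_set_def)
      then obtain d where d: "d > 0" "\<And>a b. a < x \<and> x < b \<and> b - a < d \<Longrightarrow> F b - F a \<ge> r * (b - a)"
        by (meson not_le)
      show ?thesis
      proof (intro exI[of _ d] conjI allI impI d(1))
        fix a b assume ab: "a < x \<and> x < b \<and> b - a < d"
        have "(l - e) * (b - a) \<le> r * (b - a)" using r ab by (intro mult_right_mono) auto
        then show "F b - F a \<ge> (l - e) * (b - a)" using d(2)[OF ab] by linarith
      qed
    qed
    have "(F has_derivative (\<lambda>h. l * h)) (at x)"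
      unfolding has_derivative_at_alt
    proof (intro conjI allI impI)
      fix e :: real assume "e > 0"
      then obtain d1 d2 where d: "d1 > 0" "d2 > 0"
        "\<And>a b. a < x \<Longrightarrow> x < b \<Longrightarrow> b - a < d1 \<Longrightarrow> F b - F a \<le> (l + e) * (b - a)"
        "\<And>a b. a < x \<Longrightarrow> x < b \<Longrightarrow> b - a < d2 \<Longrightarrow> F b - F a \<ge> (l - e) * (b - a)"
        using upper lower by metis
      define d where "d = min d1 d2"
      have dd: "d > 0"
        "\<And>a b. a < x \<Longrightarrow> x < b \<Longrightarrow> b - a < d \<Longrightarrow> (l - e) * (b - a) \<le> F b - F a \<and> F b - F a \<le> (l + e) * (b - a)"
        using d by (auto simp: d_def)
      \<comment> \<open>The slope bounds concern intervals with \<open>x\<close> strictly inside,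
        whereas the derivative compares \<open>x\<close> itself with \<open>y\<close>. Continuity of
        \<open>F\<close> lets the other endpoint tend to \<open>x\<close>.\<close>
      have Flim: "(F \<longlongrightarrow> F x) (at x within X)" for X
        using cont by (meson continuous_on_eq_continuous_within iso_tuple_UNIV_I continuous_within tendsto_within_subset subset_UNIV)
      have "\<bar>F y - F x - l * (y - x)\<bar> \<le> e * \<bar>y - x\<bar>" if y: "\<bar>y - x\<bar> < d" for y
      proof -
        consider "y = x" | "y > x" | "y < x" by linarith
        then show ?thesis
        proof cases
          case 2
          have ev: "\<forall>\<^sub>F a in at_left x. (l - e) * (y - a) \<le> F y - F a \<and> F y - F a \<le> (l + e) * (y - a)"
            unfolding eventually_at_left_field
            using y 2 dd by (intro exI[of _ "y - d"]) auto
          have "(l - e) * (y - x) \<le> F y - F x"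
            by (rule tendsto_le[of "at_left x" "\<lambda>a. F y - F a" _ "\<lambda>a. (l - e) * (y - a)"])
               (auto intro!: tendsto_intros Flim eventually_mono[OF ev])
          moreover have "F y - F x \<le> (l + e) * (y - x)"
            by (rule tendsto_le[of "at_left x" "\<lambda>a. (l + e) * (y - a)" _ "\<lambda>a. F y - F a"])
               (auto intro!: tendsto_intros Flim eventually_mono[OF ev])
          ultimately show ?thesis using 2 by (simp add: abs_le_iff algebra_simps)
        next
          case 3
          have ev: "\<forall>\<^sub>F b in at_right x. (l - e) * (b - y) \<le> F b - F y \<and> F b - F y \<le> (l + e) * (b - y)"
            unfolding eventually_at_right_field
            using y 3 dd by (intro exI[of _ "y + d"]) auto
          have "(l - e) * (x - y) \<le> F x - F y"
            by (rule tendsto_le[of "at_right x" "\<lambda>b. F b - F y" _ "\<lambda>b. (l - e) * (b - y)"])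
               (auto intro!: tendsto_intros Flim eventually_mono[OF ev])
          moreover have "F x - F y \<le> (l + e) * (x - y)"
            by (rule tendsto_le[of "at_right x" "\<lambda>b. (l + e) * (b - y)" _ "\<lambda>b. F b - F y"])
               (auto intro!: tendsto_intros Flim eventually_mono[OF ev])
          ultimately show ?thesis using 3 by (simp add: abs_le_iff algebra_simps)
        qed simp
      qed
      with dd(1) show "\<exists>d>0. \<forall>y. norm (y - x) < d \<longrightarrow> norm (F y - F x - l * (y - x)) \<le> e * norm (y - x)"
        by auto
    qed (rule bounded_linear_mult_right)
    then show ?case unfolding differentiable_def by blast
  qed
qed

end

section \<open>Absolutely continuous functions\<close>

text \<open>The definition speaks of numbered families, but the cells of a tagged division form a
  finite set of pairs; an enumeration transfers the estimate to an arbitrary index set.\<close>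

lemma absolutely_contD_finite:
  fixes F :: "real \<Rightarrow> real"
  assumes "absolutely_cont l r F" "\<epsilon> > 0"
  obtains \<delta> where "\<delta> > 0"
    "\<And>I lo hi. finite I \<Longrightarrow> (\<And>i. i \<in> I \<Longrightarrow> l \<le> lo i \<and> lo i \<le> hi i \<and> hi i \<le> r) \<Longrightarrow>
      disjoint_family_on (\<lambda>i. {lo i<..<hi i}) I \<Longrightarrow> (\<Sum>i\<in>I. hi i - lo i) < \<delta> \<Longrightarrow>
      (\<Sum>i\<in>I. \<bar>F (hi i) - F (lo i)\<bar>) < \<epsilon>"
proof -
  obtain \<delta> where \<delta>: "\<delta> > 0" and *: "\<And>(n::nat) a b.
        (\<forall>k<n. l \<le> a k \<and> a k \<le> b k \<and> b k \<le> r) \<Longrightarrow>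
        disjoint_family_on (\<lambda>k. {a k<..<b k}) {..<n} \<Longrightarrow>
        (\<Sum>k<n. b k - a k) < \<delta> \<Longrightarrow> (\<Sum>k<n. \<bar>F (b k) - F (a k)\<bar>) < \<epsilon>"
    using assms unfolding absolutely_cont_def by blast
  show thesis
  proof (rule that[OF \<delta>])
    fix I :: "'a set" and lo hi :: "'a \<Rightarrow> real"
    assume I: "finite I" "\<And>i. i \<in> I \<Longrightarrow> l \<le> lo i \<and> lo i \<le> hi i \<and> hi i \<le> r"
      "disjoint_family_on (\<lambda>i. {lo i<..<hi i}) I" "(\<Sum>i\<in>I. hi i - lo i) < \<delta>"
    obtain e where e: "bij_betw e {..<card I} I"
      using ex_bij_betw_nat_finite[OF I(1)] by (auto simp: atLeast0LessThan)
    have reindex: "(\<Sum>i\<in>I. g i) = (\<Sum>k<card I. g (e k))" for g :: "'a \<Rightarrow> real"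
      by (rule sum.reindex_bij_betw[OF e, symmetric])
    have "(\<Sum>k<card I. \<bar>F (hi (e k)) - F (lo (e k))\<bar>) < \<epsilon>"
    proof (rule *)
      show "\<forall>k<card I. l \<le> lo (e k) \<and> lo (e k) \<le> hi (e k) \<and> hi (e k) \<le> r"
        using I(2) e by (auto simp: bij_betw_def)
      show "disjoint_family_on (\<lambda>k. {lo (e k)<..<hi (e k)}) {..<card I}"
        using I(3) e unfolding disjoint_family_on_def bij_betw_def inj_on_def by (metis imageI)
      show "(\<Sum>k<card I. hi (e k) - lo (e k)) < \<delta>" using I(4) by (simp add: reindex)
    qed
    then show "(\<Sum>i\<in>I. \<bar>F (hi i) - F (lo i)\<bar>) < \<epsilon>" by (simp add: reindex)
  qed
qed

lemma absolutely_cont_subset: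
  assumes "absolutely_cont l r F" "l \<le> l'" "r' \<le> r"
  shows "absolutely_cont l' r' F"
  unfolding absolutely_cont_def
proof (intro allI impI)
  fix \<epsilon> :: real assume "\<epsilon> > 0"
  with assms(1) obtain \<delta> where \<delta>: "\<delta> > 0" and *: "\<And>(n::nat) a b.
        (\<forall>k<n. l \<le> a k \<and> a k \<le> b k \<and> b k \<le> r) \<Longrightarrow>
        disjoint_family_on (\<lambda>k. {a k<..<b k}) {..<n} \<Longrightarrow>
        (\<Sum>k<n. b k - a k) < \<delta> \<Longrightarrow> (\<Sum>k<n. \<bar>F (b k) - F (a k)\<bar>) < \<epsilon>"
    unfolding absolutely_cont_def by blast
  show "\<exists>\<delta>>0. \<forall>(n::nat) a b.
        (\<forall>k<n. l' \<le> a k \<and> a k \<le> b k \<and> b k \<le> r') \<longrightarrow>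
        disjoint_family_on (\<lambda>k. {a k<..<b k}) {..<n} \<longrightarrow>
        (\<Sum>k<n. b k - a k) < \<delta> \<longrightarrow>
        (\<Sum>k<n. \<bar>F (b k) - F (a k)\<bar>) < \<epsilon>"
  proof (intro exI[of _ \<delta>] conjI allI impI \<delta>)
    fix n :: nat and a b :: "nat \<Rightarrow> real"
    assume "\<forall>k<n. l' \<le> a k \<and> a k \<le> b k \<and> b k \<le> r'"
      "disjoint_family_on (\<lambda>k. {a k<..<b k}) {..<n}" "(\<Sum>k<n. b k - a k) < \<delta>"
    then show "(\<Sum>k<n. \<bar>F (b k) - F (a k)\<bar>) < \<epsilon>"
      using assms(2,3) by (intro *) (force, auto)
  qed
qed

lemma absolutely_cont_Lipschitz:
  assumes "\<And>s t. l \<le> s \<Longrightarrow> s \<le> t \<Longrightarrow> t \<le> r \<Longrightarrow> \<bar>F t - F s\<bar> \<le> L * (t - s)"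
  shows "absolutely_cont l r F"
  unfolding absolutely_cont_def
proof (intro allI impI)
  fix \<epsilon> :: real assume "\<epsilon> > 0"
  \<comment> \<open>\<open>L\<close> may be 0 or negative, so a positive constant is substituted
    before dividing by it.\<close>
  define L' where "L' = max L 1"
  have L': "L' > 0" "L \<le> L'" by (auto simp: L'_def)
  show "\<exists>\<delta>>0. \<forall>(n::nat) a b.
        (\<forall>k<n. l \<le> a k \<and> a k \<le> b k \<and> b k \<le> r) \<longrightarrow>
        disjoint_family_on (\<lambda>k. {a k<..<b k}) {..<n} \<longrightarrow>
        (\<Sum>k<n. b k - a k) < \<delta> \<longrightarrow>
        (\<Sum>k<n. \<bar>F (b k) - F (a k)\<bar>) < \<epsilon>"
  proof (intro exI[of _ "\<epsilon> / L'"] conjI allI impI)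
    show "\<epsilon> / L' > 0" using L' \<open>\<epsilon> > 0\<close> by simp
    fix n :: nat and a b :: "nat \<Rightarrow> real"
    assume ab: "\<forall>k<n. l \<le> a k \<and> a k \<le> b k \<and> b k \<le> r"
      and small: "(\<Sum>k<n. b k - a k) < \<epsilon> / L'"
    have "(\<Sum>k<n. \<bar>F (b k) - F (a k)\<bar>) \<le> (\<Sum>k<n. L' * (b k - a k))"
    proof (rule sum_mono)
      fix k assume "k \<in> {..<n}"
      with ab have k: "l \<le> a k" "a k \<le> b k" "b k \<le> r" by auto
      have "L * (b k - a k) \<le> L' * (b k - a k)" using k L' by (intro mult_right_mono) auto
      with assms[OF k] show "\<bar>F (b k) - F (a k)\<bar> \<le> L' * (b k - a k)" by linarith
    qed
    also have "\<dots> = L' * (\<Sum>k<n. b k - a k)" by (rule sum_distrib_left[symmetric])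
    also have "\<dots> < \<epsilon>" using small L' by (simp add: field_simps)
    finally show "(\<Sum>k<n. \<bar>F (b k) - F (a k)\<bar>) < \<epsilon>" .
  qed
qed

lemma absolutely_cont_continuous_on:
  assumes "absolutely_cont l r F"
  shows "continuous_on {l..r} F"
  unfolding continuous_on_iff
proof (intro ballI allI impI)
  fix x e :: real assume x: "x \<in> {l..r}" and "e > 0"
  obtain \<delta> where \<delta>: "\<delta> > 0"
    "\<And>(I::unit set) lo hi. finite I \<Longrightarrow> (\<And>i. i \<in> I \<Longrightarrow> l \<le> lo i \<and> lo i \<le> hi i \<and> hi i \<le> r) \<Longrightarrow>
      disjoint_family_on (\<lambda>i. {lo i<..<hi i}) I \<Longrightarrow> (\<Sum>i\<in>I. hi i - lo i) < \<delta> \<Longrightarrow>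
      (\<Sum>i\<in>I. \<bar>F (hi i) - F (lo i)\<bar>) < e"
    using absolutely_contD_finite[OF assms \<open>e > 0\<close>] by blast
  have *: "\<bar>F t - F s\<bar> < e" if "l \<le> s" "s \<le> t" "t \<le> r" "t - s < \<delta>" for s t
    using \<delta>(2)[of "{()}" "\<lambda>_. s" "\<lambda>_. t"] that by (simp add: disjoint_family_on_def)
  show "\<exists>d>0. \<forall>x'\<in>{l..r}. dist x' x < d \<longrightarrow> dist (F x') (F x) < e"
  proof (intro exI[of _ \<delta>] conjI ballI impI \<delta>(1))
    fix y assume "y \<in> {l..r}" "dist y x < \<delta>"
    then show "dist (F y) (F x) < e"
      using *[of x y] *[of y x] x by (cases "x \<le> y") (auto simp: dist_real_def abs_minus_commute)
  qed
qed

text \<open>The gauge sends the tags in the exceptional null set into an open set of small measure, where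
  absolute continuity controls the increments.\<close>

lemma absolutely_cont_has_integral:
  fixes F f :: "real \<Rightarrow> real"
  assumes lr: "l \<le> r" and AC: "absolutely_cont l r F"
    and deriv: "AE t in lebesgue_on {l..r}. (F has_real_derivative f t) (at t within {l..r})"
  shows "(f has_integral (F r - F l)) {l..r}"
proof -
  define N where "N = {t\<in>{l..r}. \<not> (F has_real_derivative f t) (at t within {l..r})}"
  have "AE t in lebesgue. t \<notin> N"
    using deriv by (subst (asm) AE_restrict_space_iff) (auto simp: N_def)
  then have N: "N \<in> null_sets lebesgue"
    by (simp add: AE_iff_null_sets completion.AE_iff_null_sets)
  \<comment> \<open>With the value 0 on \<open>N\<close>, cells tagged in \<open>N\<close>
    contribute nothing to the Riemann sum and only the increments of \<open>F\<close> over them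
    remain to be estimated. The null set is restored at the end.\<close>
  define g where "g t = (if t \<in> N then 0 else f t)" for t
  have "(g has_integral (F r - F l)) {l..r}"
    unfolding has_integral_real
  proof (intro allI impI)
    fix e :: real assume "e > 0"
    define e' where "e' = e / (2 * (r - l + 1))"
    have e': "e' > 0" "e' * (r - l) < e / 2"
      using \<open>e > 0\<close> lr by (auto simp: e'_def field_simps)
    obtain \<delta> where \<delta>: "\<delta> > 0"
      "\<And>(I::(real \<times> real set) set) lo hi. finite I \<Longrightarrow> (\<And>i. i \<in> I \<Longrightarrow> l \<le> lo i \<and> lo i \<le> hi i \<and> hi i \<le> r) \<Longrightarrow>
        disjoint_family_on (\<lambda>i. {lo i<..<hi i}) I \<Longrightarrow> (\<Sum>i\<in>I. hi i - lo i) < \<delta> \<Longrightarrow>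
        (\<Sum>i\<in>I. \<bar>F (hi i) - F (lo i)\<bar>) < e / 2"
      using absolutely_contD_finite[OF AC half_gt_zero[OF \<open>e > 0\<close>]] by blast
    obtain W where W: "open W" "N \<subseteq> W" "W - N \<in> lmeasurable" "emeasure lebesgue (W - N) < ennreal \<delta>"
      using sets_lebesgue_outer_open[of N \<delta>] N \<delta>(1) by (auto simp: null_sets_def)
    have W\<delta>: "emeasure lebesgue W < ennreal \<delta>"
    proof -
      have "emeasure lebesgue W \<le> emeasure lebesgue ((W - N) \<union> N)"
        using W N by (intro emeasure_mono) auto
      also have "\<dots> = emeasure lebesgue (W - N)"
        using W N by (intro emeasure_Un_null_set) (auto simp: fmeasurable_def)
      finally show ?thesis using W(4) by simp
    qed
    have "\<exists>d>0. (x \<in> N \<longrightarrow> ball x d \<subseteq> W) \<and>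
        (x \<in> {l..r} - N \<longrightarrow> (\<forall>y\<in>{l..r}. \<bar>y - x\<bar> < d \<longrightarrow> \<bar>F y - F x - f x * (y - x)\<bar> \<le> e' * \<bar>y - x\<bar>))" for x
    proof (cases "x \<in> N")
      case True
      with W(1,2) obtain d where "d > 0" "ball x d \<subseteq> W" by (meson openE subsetD)
      with True show ?thesis by blast
    next
      case False
      show ?thesis
      proof (cases "x \<in> {l..r}")
        case True
        with False have "(F has_derivative (*) (f x)) (at x within {l..r})"
          by (simp add: N_def has_field_derivative_def)
        then show ?thesis using False e'(1) unfolding has_derivative_within_alt
          by (auto simp: real_norm_def)
      qed (use False in \<open>auto intro: exI[of _ 1]\<close>)
    qed
    then obtain d where d: "\<And>x. d x > 0" "\<And>x. x \<in> N \<Longrightarrow> ball x (d x) \<subseteq> W"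
      "\<And>x y. x \<in> {l..r} - N \<Longrightarrow> y \<in> {l..r} \<Longrightarrow> \<bar>y - x\<bar> < d x \<Longrightarrow> \<bar>F y - F x - f x * (y - x)\<bar> \<le> e' * \<bar>y - x\<bar>"
      by metis
    show "\<exists>\<gamma>. gauge \<gamma> \<and> (\<forall>\<D>. \<D> tagged_division_of {l..r} \<and> \<gamma> fine \<D> \<longrightarrow>
        norm ((\<Sum>(x, k)\<in>\<D>. measure lborel k *\<^sub>R g x) - (F r - F l)) < e)"
    proof (intro exI[of _ "\<lambda>x. ball x (d x)"] conjI allI impI)
      show "gauge (\<lambda>x. ball x (d x))" using d(1) gauge_ball_dependent by blast
      fix \<D> assume "\<D> tagged_division_of {l..r} \<and> (\<lambda>x. ball x (d x)) fine \<D>"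
      then have D: "\<D> tagged_division_of {l..r}" and fine: "(\<lambda>x. ball x (d x)) fine \<D>" by auto
      note Dd = tagged_division_ofD[OF D]
      have cell: "\<exists>u v. K = {u..v} \<and> Inf K = u \<and> Sup K = v \<and> measure lborel K = v - u \<and> u \<le> x \<and> x \<le> v \<and> l \<le> u \<and> v \<le> r
           \<and> {u..v} \<subseteq> ball x (d x) \<and> x \<in> {l..r}"
        if "(x, K) \<in> \<D>" for x K
      proof -
        obtain u v where K: "K = {u..v}" using Dd(4)[OF \<open>(x, K) \<in> \<D>\<close>] by (auto simp: box_real)
        have "x \<in> K" "K \<subseteq> {l..r}" "K \<subseteq> ball x (d x)"
          using Dd(2,3)[OF that] fine that by (auto simp: fine_def)
        with K show ?thesis by (intro exI[of _ u] exI[of _ v]) auto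
      qed
      \<comment> \<open>Cells tagged in \<open>N\<close> lie in \<open>W\<close> and have small
        total length, so absolute continuity applies; the others are controlled by differentiability
        at the tag.\<close>
      define D1 where "D1 = {i\<in>\<D>. fst i \<in> N}"
      define D2 where "D2 = {i\<in>\<D>. fst i \<notin> N}"
      have fin: "finite \<D>" "finite D1" "finite D2" using Dd(1) by (auto simp: D1_def D2_def)
      let ?dF = "\<lambda>(x::real, K). F (Sup K) - F (Inf K)"
      have split: "sum h \<D> = sum h D1 + sum h D2" for h :: "real \<times> real set \<Rightarrow> real"
      proof -
        have "\<D> = D1 \<union> D2" "D1 \<inter> D2 = {}" by (auto simp: D1_def D2_def)
        then show ?thesis using fin by (simp add: sum.union_disjoint)
      qed
      have disj: "disjoint_family_on (\<lambda>i. {Inf (snd i)<..<Sup (snd i)}) \<D>"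
        unfolding disjoint_family_on_def
      proof (intro ballI impI)
        fix i j assume ij: "i \<in> \<D>" "j \<in> \<D>" "i \<noteq> j"
        obtain x K where i: "i = (x, K)" by (cases i)
        obtain x' K' where j: "j = (x', K')" by (cases j)
        have "interior K \<inter> interior K' = {}" using Dd(5)[of x K x' K'] ij i j by auto
        moreover obtain u v where "K = {u..v}" "Inf K = u" "Sup K = v" using cell[of x K] ij i by blast
        moreover obtain u' v' where "K' = {u'..v'}" "Inf K' = u'" "Sup K' = v'" using cell[of x' K'] ij j by blast
        ultimately show "{Inf (snd i)<..<Sup (snd i)} \<inter> {Inf (snd j)<..<Sup (snd j)} = {}"
          by (simp add: i j)
      qed
      have sub: "l \<le> Inf (snd i) \<and> Inf (snd i) \<le> Sup (snd i) \<and> Sup (snd i) \<le> r" if "i \<in> \<D>" for i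
        using cell[of "fst i" "snd i"] that by force
      have "(\<Sum>i\<in>D1. \<bar>F (Sup (snd i)) - F (Inf (snd i))\<bar>) < e / 2"
      proof (rule \<delta>(2)[OF fin(2)])
        show "l \<le> Inf (snd i) \<and> Inf (snd i) \<le> Sup (snd i) \<and> Sup (snd i) \<le> r" if "i \<in> D1" for i
          using sub that by (simp add: D1_def)
        show dj1: "disjoint_family_on (\<lambda>i. {Inf (snd i)<..<Sup (snd i)}) D1"
          using disj by (rule disjoint_family_on_mono[rotated]) (auto simp: D1_def)
        have "ennreal (\<Sum>i\<in>D1. Sup (snd i) - Inf (snd i)) = (\<Sum>i\<in>D1. emeasure lebesgue {Inf (snd i)<..<Sup (snd i)})"
          using sub by (subst sum_ennreal[symmetric]) (auto simp: D1_def)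
        also have "\<dots> = emeasure lebesgue (\<Union>i\<in>D1. {Inf (snd i)<..<Sup (snd i)})"
          using fin(2) dj1 by (intro sum_emeasure) auto
        also have "\<dots> \<le> emeasure lebesgue W"
        proof (intro emeasure_mono)
          show "W \<in> sets lebesgue" using W(1) by simp
          show "(\<Union>i\<in>D1. {Inf (snd i)<..<Sup (snd i)}) \<subseteq> W"
          proof (intro UN_least)
            fix i assume "i \<in> D1"
            then have "fst i \<in> N" "(fst i, snd i) \<in> \<D>" by (auto simp: D1_def)
            with cell[of "fst i" "snd i"] d(2)[of "fst i"] show "{Inf (snd i)<..<Sup (snd i)} \<subseteq> W"
              by force
          qed
        qed
        also have "\<dots> < ennreal \<delta>" by (rule W\<delta>)
        finally show "(\<Sum>i\<in>D1. Sup (snd i) - Inf (snd i)) < \<delta>"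
          using sub \<delta>(1) by (subst (asm) ennreal_less_iff) (auto intro!: sum_nonneg simp: D1_def)
      qed
      then have b1: "\<bar>\<Sum>i\<in>D1. ?dF i\<bar> < e / 2"
        by (intro le_less_trans[OF sum_abs]) (simp add: case_prod_beta)
      have "\<bar>\<Sum>i\<in>D2. measure lborel (snd i) * g (fst i) - ?dF i\<bar> \<le> (\<Sum>i\<in>D2. e' * measure lborel (snd i))"
      proof (intro order_trans[OF sum_abs] sum_mono)
        fix i assume i: "i \<in> D2"
        then have i': "(fst i, snd i) \<in> \<D>" "fst i \<notin> N" by (auto simp: D2_def)
        let ?x = "fst i"
        obtain u v where uv: "snd i = {u..v}" "Inf (snd i) = u" "Sup (snd i) = v" "measure lborel (snd i) = v - u"
          "u \<le> ?x" "?x \<le> v" "l \<le> u" "v \<le> r" "{u..v} \<subseteq> ball ?x (d ?x)" "?x \<in> {l..r}"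
          using cell[OF i'(1)] by blast
        have "u \<in> ball ?x (d ?x)" "v \<in> ball ?x (d ?x)" using subsetD[OF uv(9), of u] subsetD[OF uv(9), of v] uv(5,6) by simp_all
        then have uv': "\<bar>u - ?x\<bar> < d ?x" "\<bar>v - ?x\<bar> < d ?x" by (auto simp: dist_real_def abs_minus_commute)
        have "\<bar>F u - F ?x - f ?x * (u - ?x)\<bar> \<le> e' * (?x - u)" "\<bar>F v - F ?x - f ?x * (v - ?x)\<bar> \<le> e' * (v - ?x)"
          using d(3)[of ?x u] d(3)[of ?x v] uv uv' i' by auto
        \<comment> \<open>The tag lies between \<open>u\<close> and \<open>v\<close>, so the two
          one-sided errors add up to exactly \<open>e' * (v - u)\<close>, which is what sums over a
          division.\<close>
        then have "\<bar>(v - u) * f ?x - (F v - F u)\<bar> \<le> e' * (v - u)"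
          by (simp add: abs_le_iff algebra_simps)
        then show "\<bar>measure lborel (snd i) * g (fst i) - ?dF i\<bar> \<le> e' * measure lborel (snd i)"
          using uv i' by (simp add: g_def case_prod_beta)
      qed
      also have "\<dots> \<le> (\<Sum>i\<in>\<D>. e' * measure lborel (snd i))"
        using fin e' by (intro sum_mono2) (auto simp: D2_def)
      also have "\<dots> = e' * (r - l)"
      proof -
        have "(\<Sum>i\<in>\<D>. measure lborel (snd i)) = measure lborel {l..r}"
          using additive_content_tagged_division[of \<D> l r] D by (simp add: box_real case_prod_beta)
        then show ?thesis using lr by (simp add: sum_distrib_left[symmetric])
      qed
      finally have b2: "\<bar>\<Sum>i\<in>D2. measure lborel (snd i) * g (fst i) - ?dF i\<bar> < e / 2" using e'(2) by linarith
      have "(\<Sum>(x, k)\<in>\<D>. measure lborel k *\<^sub>R g x) = (\<Sum>i\<in>D2. measure lborel (snd i) * g (fst i))"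
        unfolding split by (simp add: case_prod_beta D1_def g_def)
      moreover have "F r - F l = (\<Sum>i\<in>D1. ?dF i) + (\<Sum>i\<in>D2. ?dF i)"
        using additive_tagged_division_1[OF lr D, of F] by (simp add: split)
      ultimately have eq: "(\<Sum>(x, k)\<in>\<D>. measure lborel k *\<^sub>R g x) - (F r - F l)
          = (\<Sum>i\<in>D2. measure lborel (snd i) * g (fst i) - ?dF i) - (\<Sum>i\<in>D1. ?dF i)"
        by (simp add: sum_subtractf)
      show "norm ((\<Sum>(x, k)\<in>\<D>. measure lborel k *\<^sub>R g x) - (F r - F l)) < e"
        unfolding real_norm_def eq using b1 b2 by linarith
    qed
  qed
  then show ?thesis
    by (rule has_integral_spike[rotated 2, of _ _ _ N])
       (use N in \<open>auto simp: g_def negligible_iff_null_sets\<close>)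
qed

section \<open>Controllability\<close>

text \<open>The regularity class for explicit competitors: a Lipschitz bound gives absolute
  continuity at once and survives concatenation, and the set \<open>S\<close> collects the junction
  times where the derivative may jump.\<close>

definition ramp :: "real \<Rightarrow> real \<Rightarrow> real set \<Rightarrow> (real \<Rightarrow> real) \<Rightarrow> (real \<Rightarrow> real) \<Rightarrow> bool" where
  "ramp T L S f f' \<longleftrightarrow>
     (\<forall>s t. 0 \<le> s \<longrightarrow> s \<le> t \<longrightarrow> t \<le> T \<longrightarrow> \<bar>f t - f s\<bar> \<le> L * (t - s)) \<and>
     (\<forall>t\<in>{0<..<T} - S. (f has_real_derivative f' t) (at t))"

definition join :: "real \<Rightarrow> (real \<Rightarrow> real) \<Rightarrow> (real \<Rightarrow> real) \<Rightarrow> real \<Rightarrow> real" where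
  "join T f g t = (if t \<le> T then f t else g (t - T))"

lemma ramp_absolutely_cont: "ramp T L S f f' \<Longrightarrow> absolutely_cont 0 T f"
  by (intro absolutely_cont_Lipschitz[of 0 T f L]) (auto simp: ramp_def)

lemma ramp_mono:
  assumes "ramp T L S f f'" "L \<le> L'"
  shows "ramp T L' S f f'"
proof -
  have "\<bar>f t - f s\<bar> \<le> L' * (t - s)" if "0 \<le> s" "s \<le> t" "t \<le> T" for s t
  proof -
    have "\<bar>f t - f s\<bar> \<le> L * (t - s)" using assms(1) that by (auto simp: ramp_def)
    also have "\<dots> \<le> L' * (t - s)" using assms(2) that by (intro mult_right_mono) auto
    finally show ?thesis .
  qed
  with assms(1) show ?thesis by (auto simp: ramp_def)
qed

lemma ramp_continuous_deriv:
  assumes cont: "continuous_on {0..T} f"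
    and deriv: "\<And>t. 0 < t \<Longrightarrow> t < T \<Longrightarrow> (f has_real_derivative f' t) (at t)"
    and bound: "\<And>t. 0 < t \<Longrightarrow> t < T \<Longrightarrow> \<bar>f' t\<bar> \<le> L"
  shows "ramp T L S f f'"
  unfolding ramp_def
proof (intro conjI allI impI ballI)
  fix s t assume st: "0 \<le> s" "s \<le> t" "t \<le> T"
  show "\<bar>f t - f s\<bar> \<le> L * (t - s)"
  proof (cases "s = t")
    case False
    with st have "s < t" by simp
    then obtain z where z: "s < z" "z < t" "f t - f s = (t - s) * f' z"
    proof (rule mvt)
      show "continuous_on {s..t} f" using cont by (rule continuous_on_subset) (use st in auto)
      show "(f has_derivative (\<lambda>h. h * f' z)) (at z)" if "s < z" "z < t" for z
        using deriv[of z] st that by (simp add: has_field_derivative_def mult_commute_abs)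
    qed
    then have "\<bar>f t - f s\<bar> = (t - s) * \<bar>f' z\<bar>" using st by (simp add: abs_mult)
    also have "\<dots> \<le> (t - s) * L" using z st bound[of z] by (intro mult_left_mono) auto
    finally show ?thesis by (simp add: mult.commute)
  qed simp
qed (use deriv in auto)

text \<open>Across the junction the triangle inequality through the common value
  \<open>f T1 = g 0\<close> keeps the Lipschitz constant. Away from it the derivative is local, so
  only \<open>T1\<close> joins the exceptional times.\<close>

lemma ramp_join:
  assumes f: "ramp T1 L S1 f f'" and g: "ramp T2 L S2 g g'" and eq: "f T1 = g 0"
    and T: "0 < T1" "0 < T2"
  shows "ramp (T1 + T2) L (S1 \<union> (+) T1 ` S2 \<union> {T1}) (join T1 f g) (join T1 f' g')"
  unfolding ramp_def
proof (intro conjI allI impI ballI)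
  fix s t assume st: "0 \<le> s" "s \<le> t" "t \<le> T1 + T2"
  have lf: "\<bar>f t - f s\<bar> \<le> L * (t - s)" if "0 \<le> s" "s \<le> t" "t \<le> T1" for s t
    using f that by (auto simp: ramp_def)
  have lg: "\<bar>g t - g s\<bar> \<le> L * (t - s)" if "0 \<le> s" "s \<le> t" "t \<le> T2" for s t
    using g that by (auto simp: ramp_def)
  consider "t \<le> T1" | "T1 < s" | "s \<le> T1" "T1 < t" by linarith
  then show "\<bar>join T1 f g t - join T1 f g s\<bar> \<le> L * (t - s)"
  proof cases
    case 1 then show ?thesis using st lf[of s t] by (simp add: join_def)
  next
    case 2 then show ?thesis using st lg[of "s - T1" "t - T1"] by (simp add: join_def)
  next
    case 3
    have "\<bar>join T1 f g t - join T1 f g s\<bar> = \<bar>(g (t - T1) - g 0) + (f T1 - f s)\<bar>"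
      using 3 eq by (simp add: join_def)
    also have "\<dots> \<le> L * (t - T1 - 0) + L * (T1 - s)"
      using lg[of 0 "t - T1"] lf[of s T1] st 3 by (intro order_trans[OF abs_triangle_ineq add_mono]) auto
    also have "\<dots> = L * (t - s)" by (simp add: algebra_simps)
    finally show ?thesis .
  qed
next
  fix t assume t: "t \<in> {0<..<T1 + T2} - (S1 \<union> (+) T1 ` S2 \<union> {T1})"
  show "(join T1 f g has_real_derivative join T1 f' g' t) (at t)"
  proof (cases "t < T1")
    case True
    with t f have "(f has_real_derivative f' t) (at t)" by (auto simp: ramp_def)
    then have "(join T1 f g has_real_derivative f' t) (at t)"
      by (rule has_field_derivative_transform_within_open[where S = "{..<T1}"])
         (use True in \<open>auto simp: join_def\<close>)
    then show ?thesis using True by (simp add: join_def)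
  next
    case False
    with t have t1: "T1 < t" by auto
    have "t - T1 \<notin> S2" using t by (auto simp: image_iff)
    with t t1 g have "(g has_real_derivative g' (t - T1)) (at (t - T1))"
      by (auto simp: ramp_def)
    then have "((\<lambda>s. g (s - T1)) has_real_derivative g' (t - T1)) (at t)"
      using DERIV_shift[of g "g' (t - T1)" t "- T1"] by simp
    then have "(join T1 f g has_real_derivative g' (t - T1)) (at t)"
      by (rule has_field_derivative_transform_within_open[where S = "{T1<..}"])
         (use t1 in \<open>auto simp: join_def\<close>)
    then show ?thesis using t1 by (simp add: join_def)
  qed
qed

text \<open>Here the third component of a state is an angle lifted to the reals.\<close>

definition steers :: "real \<times> real \<times> real \<times> real \<Rightarrow> real \<times> real \<times> real \<times> real \<Rightarrow> bool" where
  "steers a b \<longleftrightarrow> (\<exists>T L S u x y \<theta> \<kappa>. 0 < T \<and> finite S \<and>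
     u \<in> borel_measurable borel \<and> (\<forall>t. \<bar>u t\<bar> \<le> L) \<and>
     ramp T L S x (\<lambda>t. cos (\<theta> t)) \<and> ramp T L S y (\<lambda>t. sin (\<theta> t)) \<and>
     ramp T L S \<theta> \<kappa> \<and> ramp T L S \<kappa> u \<and>
     a = (x 0, y 0, \<theta> 0, \<kappa> 0) \<and> b = (x T, y T, \<theta> T, \<kappa> T))"

lemma steersI:
  assumes "0 < T" "finite S" "u \<in> borel_measurable borel" "\<And>t. \<bar>u t\<bar> \<le> L"
     "ramp T L S x (\<lambda>t. cos (\<theta> t))" "ramp T L S y (\<lambda>t. sin (\<theta> t))"
     "ramp T L S \<theta> \<kappa>" "ramp T L S \<kappa> u"
     "a = (x 0, y 0, \<theta> 0, \<kappa> 0)" "b = (x T, y T, \<theta> T, \<kappa> T)"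
  shows "steers a b"
  using assms unfolding steers_def by blast

lemma steers_trans:
  assumes "steers a b" "steers b c"
  shows "steers a c"
proof -
  obtain T L S u x y \<theta> \<kappa> where 1: "0 < T" "finite S" "u \<in> borel_measurable borel" "\<And>t. \<bar>u t\<bar> \<le> L"
     "ramp T L S x (\<lambda>t. cos (\<theta> t))" "ramp T L S y (\<lambda>t. sin (\<theta> t))"
     "ramp T L S \<theta> \<kappa>" "ramp T L S \<kappa> u"
     "a = (x 0, y 0, \<theta> 0, \<kappa> 0)" "b = (x T, y T, \<theta> T, \<kappa> T)"
    using assms(1) unfolding steers_def by blast
  obtain T' L' S' u' x' y' \<theta>' \<kappa>' where 2: "0 < T'" "finite S'" "u' \<in> borel_measurable borel" "\<And>t. \<bar>u' t\<bar> \<le> L'"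
     "ramp T' L' S' x' (\<lambda>t. cos (\<theta>' t))" "ramp T' L' S' y' (\<lambda>t. sin (\<theta>' t))"
     "ramp T' L' S' \<theta>' \<kappa>'" "ramp T' L' S' \<kappa>' u'"
     "b = (x' 0, y' 0, \<theta>' 0, \<kappa>' 0)" "c = (x' T', y' T', \<theta>' T', \<kappa>' T')"
    using assms(2) unfolding steers_def by blast
  let ?L = "max L L'" and ?S = "S \<union> (+) T ` S' \<union> {T}"
  have glue: "ramp (T + T') ?L ?S (join T f g) (join T f' g')"
    if "ramp T L S f f'" "ramp T' L' S' g g'" "f T = g 0" for f g f' g'
    by (rule ramp_join[OF ramp_mono[OF that(1)] ramp_mono[OF that(2)] that(3) 1(1) 2(1)]) auto
  have comp: "(\<lambda>t. h (join T \<theta> \<theta>' t)) = join T (\<lambda>t. h (\<theta> t)) (\<lambda>t. h (\<theta>' t))" for h :: "real \<Rightarrow> real"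
    by (auto simp: join_def)
  show ?thesis
  proof (rule steersI)
    show "ramp (T + T') ?L ?S (join T x x') (\<lambda>t. cos (join T \<theta> \<theta>' t))"
      unfolding comp[of cos] using glue[OF 1(5) 2(5)] 1(10) 2(9) by simp
    show "ramp (T + T') ?L ?S (join T y y') (\<lambda>t. sin (join T \<theta> \<theta>' t))"
      unfolding comp[of sin] using glue[OF 1(6) 2(6)] 1(10) 2(9) by simp
    show "ramp (T + T') ?L ?S (join T \<theta> \<theta>') (join T \<kappa> \<kappa>')"
         "ramp (T + T') ?L ?S (join T \<kappa> \<kappa>') (join T u u')"
      using glue[OF 1(7) 2(7)] glue[OF 1(8) 2(8)] 1(10) 2(9) by auto
    show "join T u u' \<in> borel_measurable borel"
      using 1(3) 2(3) unfolding join_def by measurable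
    show "\<bar>join T u u' t\<bar> \<le> ?L" for t
      using 1(4)[of t] 2(4)[of "t - T"] by (auto simp: join_def)
  qed (use 1(1,2,9,10) 2(1,2,9,10) in \<open>auto simp: join_def\<close>)
qed

lemma steers_straight:
  assumes "0 < d"
  shows "steers (x, y, \<theta>, 0) (x + d * cos \<theta>, y + d * sin \<theta>, \<theta>, 0)"
  by (rule steersI[where T = d and L = 1 and S = "{}" and u = "\<lambda>_. 0" and \<theta> = "\<lambda>_. \<theta>" and \<kappa> = "\<lambda>_. 0"
        and x = "\<lambda>t. x + t * cos \<theta>" and y = "\<lambda>t. y + t * sin \<theta>"])
     (use assms in \<open>auto intro!: ramp_continuous_deriv continuous_intros derivative_eq_intros\<close>)

text \<open>A quadratic curvature profile on \<open>[0, 1]\<close> meets both end curvatures, and its remaining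
  coefficient adjusts the total turning angle.\<close>

lemma steers_turn:
  obtains dx dy where "\<And>x y. steers (x, y, \<theta>0, k0) (x + dx, y + dy, \<theta>1, k1)"
proof -
  \<comment> \<open>The linear interpolation of the curvatures turns by (k0 + k1)/2, and the
    integral of t - t^2 over [0, 1] is 1/6; the factor 6 makes \<open>c\<close> supply the missing
    angle.\<close>
  define c where "c = 6 * (\<theta>1 - \<theta>0 - (k0 + k1) / 2)"
  define \<kappa> where "\<kappa> t = k0 + (k1 - k0) * t + c * (t - t\<^sup>2)" for t :: real
  define \<theta> where "\<theta> t = \<theta>0 + k0 * t + (k1 - k0) * t\<^sup>2 / 2 + c * (t\<^sup>2 / 2 - t ^ 3 / 3)" for t :: real
  define u where "u t = (if t \<in> {0..1} then (k1 - k0) + c * (1 - 2 * t) else 0)" for t :: real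
  \<comment> \<open>The displacement has no elementary form. It only matters that it depends on the
    angles and curvatures and not on the starting position.\<close>
  define X where "X t = integral {0..t} (\<lambda>s. cos (\<theta> s))" for t
  define Y where "Y t = integral {0..t} (\<lambda>s. sin (\<theta> s))" for t
  have \<theta>_cont: "continuous_on A \<theta>" for A unfolding \<theta>_def by (intro continuous_intros) auto
  have \<kappa>_cont: "continuous_on A \<kappa>" for A unfolding \<kappa>_def by (intro continuous_intros)
  have \<theta>': "(\<theta> has_real_derivative \<kappa> t) (at t)" for t
    unfolding \<theta>_def \<kappa>_def by (auto intro!: derivative_eq_intros simp: power2_eq_square field_simps)
  have \<kappa>': "(\<kappa> has_real_derivative u t) (at t)" if "0 < t" "t < 1" for t
    unfolding u_def \<kappa>_def using that by (auto intro!: derivative_eq_intros simp: algebra_simps)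
  have int': "((\<lambda>t. integral {0..t} g) has_real_derivative g t) (at t)" 
    if "continuous_on {0..1} g" "0 < t" "t < 1" for g :: "real \<Rightarrow> real" and t
    using integral_has_real_derivative[of 0 1 g t] that at_within_Icc_at[of 0 t 1] by auto
  have int_cont: "continuous_on {0..1} (\<lambda>t. integral {0..t} g)" if "continuous_on {0..1} g" for g :: "real \<Rightarrow> real"
    using that by (intro indefinite_integral_continuous_1 integrable_continuous_real)
  obtain B where B: "\<And>t. t \<in> {0..1} \<Longrightarrow> \<bar>\<kappa> t\<bar> \<le> B"
  proof -
    have "compact (\<kappa> ` {0..1})" by (intro compact_continuous_image \<kappa>_cont) simp
    then have "bounded (\<kappa> ` {0..1})" by (rule compact_imp_bounded)
    then show thesis using that by (fastforce simp: bounded_iff)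
  qed
  define L where "L = max (max 1 B) (\<bar>k1 - k0\<bar> + \<bar>c\<bar>)"
  have u_bound: "\<bar>u t\<bar> \<le> \<bar>k1 - k0\<bar> + \<bar>c\<bar>" for t
  proof (cases "t \<in> {0..1}")
    case True
    then have "\<bar>c * (1 - 2 * t)\<bar> \<le> \<bar>c\<bar> * 1" unfolding abs_mult by (intro mult_left_mono) auto
    with True show ?thesis unfolding u_def by simp
  qed (auto simp: u_def)
  have ends: "\<theta> 0 = \<theta>0" "\<theta> 1 = \<theta>1" "\<kappa> 0 = k0" "\<kappa> 1 = k1" "X 0 = 0" "Y 0 = 0"
    by (simp_all add: \<theta>_def \<kappa>_def X_def Y_def c_def field_simps)
  have "steers (x, y, \<theta>0, k0) (x + X 1, y + Y 1, \<theta>1, k1)" for x y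
  proof (rule steersI)
    show "u \<in> borel_measurable borel" unfolding u_def by measurable
    show "\<bar>u t\<bar> \<le> L" for t using u_bound[of t] by (simp add: L_def)
    show "ramp 1 L {} (\<lambda>t. x + X t) (\<lambda>t. cos (\<theta> t))"
    proof (rule ramp_continuous_deriv)
      show "continuous_on {0..1} (\<lambda>t. x + X t)"
        unfolding X_def by (intro continuous_intros int_cont \<theta>_cont)
      show "((\<lambda>t. x + X t) has_real_derivative cos (\<theta> t)) (at t)" if "0 < t" "t < 1" for t
        unfolding X_def using int'[OF _ that, of "\<lambda>s. cos (\<theta> s)"] \<theta>_cont
        by (auto intro!: derivative_eq_intros continuous_intros)
      show "\<bar>cos (\<theta> t)\<bar> \<le> L" for t using abs_cos_le_one[of "\<theta> t"] unfolding L_def by linarith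
    qed
    show "ramp 1 L {} (\<lambda>t. y + Y t) (\<lambda>t. sin (\<theta> t))"
    proof (rule ramp_continuous_deriv)
      show "continuous_on {0..1} (\<lambda>t. y + Y t)"
        unfolding Y_def by (intro continuous_intros int_cont \<theta>_cont)
      show "((\<lambda>t. y + Y t) has_real_derivative sin (\<theta> t)) (at t)" if "0 < t" "t < 1" for t
        unfolding Y_def using int'[OF _ that, of "\<lambda>s. sin (\<theta> s)"] \<theta>_cont
        by (auto intro!: derivative_eq_intros continuous_intros)
      show "\<bar>sin (\<theta> t)\<bar> \<le> L" for t using abs_sin_le_one[of "\<theta> t"] unfolding L_def by linarith
    qed
    show "ramp 1 L {} \<theta> \<kappa>"
    proof (rule ramp_continuous_deriv[OF \<theta>_cont \<theta>'])
      show "\<bar>\<kappa> t\<bar> \<le> L" if "0 < t" "t < 1" for t using B[of t] that by (auto simp: L_def)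
    qed
    show "ramp 1 L {} \<kappa> u"
    proof (rule ramp_continuous_deriv[OF \<kappa>_cont \<kappa>'])
      show "\<bar>u t\<bar> \<le> L" for t using u_bound[of t] by (auto simp: L_def)
    qed auto
  qed (auto simp: ends)
  then show thesis by (rule that)
qed

text \<open>Straight runs in the four axis directions, linked by turns with fixed displacements, compensate
  any prescribed total displacement.\<close>

lemma steers_all: "steers a b"
proof -
  obtain x y \<theta> k where a: "a = (x, y, \<theta>, k)" by (cases a)
  obtain x' y' \<theta>' k' where b: "b = (x', y', \<theta>', k')" by (cases b)
  obtain p0 q0 where 0: "\<And>x y. steers (x, y, \<theta>, k) (x + p0, y + q0, 0, 0)" by (rule steers_turn) blast
  obtain p1 q1 where 1: "\<And>x y. steers (x, y, 0, 0) (x + p1, y + q1, pi / 2, 0)" by (rule steers_turn) blast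
  obtain p2 q2 where 2: "\<And>x y. steers (x, y, pi / 2, 0) (x + p2, y + q2, pi, 0)" by (rule steers_turn) blast
  obtain p3 q3 where 3: "\<And>x y. steers (x, y, pi, 0) (x + p3, y + q3, - (pi / 2), 0)" by (rule steers_turn) blast
  obtain p4 q4 where 4: "\<And>x y. steers (x, y, - (pi / 2), 0) (x + p4, y + q4, \<theta>', k')" by (rule steers_turn) blast
  define dx where "dx = x' - x - (p0 + p1 + p2 + p3 + p4)"
  define dy where "dy = y' - y - (q0 + q1 + q2 + q3 + q4)"
  have E: "steers (x, y, 0, 0) (x + d, y, 0, 0)" if "0 < d" for x y d
    using steers_straight[OF that, of x y 0] by simp
  have N: "steers (x, y, pi / 2, 0) (x, y + d, pi / 2, 0)" if "0 < d" for x y d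
    using steers_straight[OF that, of x y "pi / 2"] by simp
  have W: "steers (x, y, pi, 0) (x - d, y, pi, 0)" if "0 < d" for x y d
    using steers_straight[OF that, of x y pi] by simp
  have S: "steers (x, y, - (pi / 2), 0) (x, y - d, - (pi / 2), 0)" if "0 < d" for x y d
    using steers_straight[OF that, of x y "- (pi / 2)"] by simp
  \<comment> \<open>Straight runs need positive length. Going forward by |d| + 1 and back by |d| + 1
    - d gives the net displacement \<open>d\<close> of either sign, with both lengths
    positive.\<close>
  have pos: "0 < \<bar>d\<bar> + 1" "0 < \<bar>d\<bar> + 1 - d" for d :: real by auto
  note path = steers_trans[OF 0 steers_trans[OF E[OF pos(1)[of dx]] steers_trans[OF 1
    steers_trans[OF N[OF pos(1)[of dy]] steers_trans[OF 2 steers_trans[OF W[OF pos(2)[of dx]]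
    steers_trans[OF 3 steers_trans[OF S[OF pos(2)[of dy]] 4]]]]]]]]
  show ?thesis
    using path[of x y] unfolding a b by (simp add: dx_def dy_def)
qed

lemma proj_rep_circle: "proj_circle (rep_circle c) = c"
  by (rule Quotient_abs_rep[OF Quotient_circle])

text \<open>Nonemptiness alone is enough, with no bound on the cost: it settles the case in which
  every competitor has infinite cost, and a finite infimum provides its own competitors.\<close>

lemma ex_admissible:
  assumes "p > 0"
  shows "\<exists>T u X. admissible p X0 X1 T u X"
proof -
  obtain x0 y0 c0 k0 where X0: "X0 = (x0, y0, c0, k0)" by (cases X0)
  obtain x1 y1 c1 k1 where X1: "X1 = (x1, y1, c1, k1)" by (cases X1)
  have "steers (x0, y0, rep_circle c0, k0) (x1, y1, rep_circle c1, k1)" by (rule steers_all)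
  then obtain T L S u x y \<theta> \<kappa> where 1: "0 < T" "finite S" "u \<in> borel_measurable borel" "\<And>t. \<bar>u t\<bar> \<le> L"
     "ramp T L S x (\<lambda>t. cos (\<theta> t))" "ramp T L S y (\<lambda>t. sin (\<theta> t))"
     "ramp T L S \<theta> \<kappa>" "ramp T L S \<kappa> u"
     "(x0, y0, rep_circle c0, k0) = (x 0, y 0, \<theta> 0, \<kappa> 0)" "(x1, y1, rep_circle c1, k1) = (x T, y T, \<theta> T, \<kappa> T)"
    unfolding steers_def by blast
  define X where "X t = (x t, y t, proj_circle (\<theta> t), \<kappa> t)" for t
  \<comment> \<open>The endpoints are discarded together with the junctions, since derivatives are
    available at interior times only.\<close>
  have "finite (S \<union> {0, T})" using 1(2) by simp
  then have "AE t in lebesgue. t \<notin> S \<union> {0, T}"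
    by (intro AE_not_in) (auto simp: negligible_iff_null_sets[symmetric] negligible_finite)
  then have "AE t in lebesgue_on {0..T}. t \<notin> S \<union> {0, T}"
    by (subst AE_restrict_space_iff) auto
  moreover have "AE t in lebesgue_on {0..T}. t \<in> {0..T}" by (rule AE_I2) simp
  ultimately have "AE t in lebesgue_on {0..T}. (x has_real_derivative cos (\<theta> t)) (at t within {0..T}) \<and>
           (y has_real_derivative sin (\<theta> t)) (at t within {0..T}) \<and>
           (\<theta> has_real_derivative \<kappa> t) (at t within {0..T}) \<and>
           (\<kappa> has_real_derivative u t) (at t within {0..T})"
  proof eventually_elim
    case (elim t)
    then have "t \<in> {0<..<T} - S" by auto
    then show ?case using 1(5-8) by (auto simp: ramp_def intro: has_field_derivative_at_within)
  qed
  then have "trajectory T u X"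
    unfolding trajectory_def using ramp_absolutely_cont[OF 1(5)] ramp_absolutely_cont[OF 1(6)] ramp_absolutely_cont[OF 1(7)] ramp_absolutely_cont[OF 1(8)]
    by (intro exI[of _ x] exI[of _ y] exI[of _ \<theta>] exI[of _ \<kappa>]) (auto simp: X_def)
  moreover have "control p T u"
  proof -
    have u: "u \<in> borel_measurable (lebesgue_on {0..T})"
      using 1(3) by (intro measurable_restrict_space1 measurable_completion) auto
    have "integrable (lebesgue_on {0..T}) (\<lambda>t. \<bar>u t\<bar> powr p)"
    proof (rule finite_measure.integrable_const_bound[where B = "L powr p"])
      show "finite_measure (lebesgue_on {0..T})"
        by (intro finite_measureI) (simp add: emeasure_restrict_space emeasure_lborel_Icc_eq)
      show "AE t in lebesgue_on {0..T}. norm (\<bar>u t\<bar> powr p) \<le> L powr p"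
        using 1(4) assms by (intro AE_I2) (auto intro!: powr_mono2)
      show "(\<lambda>t. \<bar>u t\<bar> powr p) \<in> borel_measurable (lebesgue_on {0..T})"
        using u by measurable
    qed
    with 1(1) u show ?thesis by (simp add: control_def)
  qed
  moreover have "proj_circle (\<theta> 0) = c0" "proj_circle (\<theta> T) = c1"
    using 1(9,10) proj_rep_circle[of c0] proj_rep_circle[of c1]
    by auto
  ultimately have "admissible p X0 X1 T u X"
    using 1(9,10) by (simp add: admissible_def X_def X0 X1)
  then show ?thesis by blast
qed

section \<open>Primitives, convexity and uniform integrability\<close>

text \<open>Integration from -\<infinity> makes differences additive for all s \<le> t without a
  case distinction at 0. For controls supported in [0, T] the function vanishes at 0, so the initial
  curvature is added separately.\<close>

definition primitive :: "(real \<Rightarrow> real) \<Rightarrow> real \<Rightarrow> real" where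
  "primitive v t = (LINT s:{..t}|lborel. v s)"

lemma primitive_diff:
  assumes "integrable lborel v" "s \<le> t"
  shows "primitive v t - primitive v s = (LINT r:{s<..t}|lborel. v r)"
proof -
  have *: "set_integrable lborel A v" if "A \<in> sets borel" for A
    using assms(1) that unfolding set_integrable_def
    by (intro integrable_mult_indicator) auto
  have "{..t} = {..s} \<union> {s<..t}" using assms(2) by auto
  then have "primitive v t = primitive v s + (LINT r:{s<..t}|lborel. v r)"
    unfolding primitive_def by (subst set_integral_Un[symmetric]) (auto intro!: *)
  then show ?thesis by simp
qed

lemma primitive_diff_le:
  assumes "integrable lborel v" "s \<le> t"
  shows "\<bar>primitive v t - primitive v s\<bar> \<le> (LINT r:{s<..t}|lborel. \<bar>v r\<bar>)"
  unfolding primitive_diff[OF assms] set_lebesgue_integral_def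
  by (intro order_trans[OF integral_abs_bound]) (auto simp: abs_mult)

lemma primitive_mono:
  assumes "integrable lborel v" "\<And>s. 0 \<le> v s"
  shows "mono (primitive v)"
proof (rule monoI)
  fix s t :: real assume "s \<le> t"
  have "0 \<le> (LINT r:{s<..t}|lborel. v r)"
    unfolding set_lebesgue_integral_def using assms(2) by (intro integral_nonneg_AE) auto
  then show "primitive v s \<le> primitive v t" using primitive_diff[OF assms(1) \<open>s \<le> t\<close>] by simp
qed

lemma primitive_eq_0:
  assumes "\<And>s. s < 0 \<Longrightarrow> v s = 0" "t \<le> 0"
  shows "primitive v t = 0"
proof -
  have "AE s in lborel. indicator {..t} s *\<^sub>R v s = 0"
    using AE_lborel_singleton[of 0] by eventually_elim (use assms in \<open>auto simp: indicator_def\<close>)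
  then show ?thesis
    unfolding primitive_def set_lebesgue_integral_def by (rule integral_eq_zero_AE)
qed

text \<open>The tangent of \<psi> at the mean value lies below \<psi>. Integrated over the interval,
  its linear part cancels and only \<psi> of the mean is left.\<close>

lemma Jensen_interval:
  fixes \<psi> v :: "real \<Rightarrow> real"
  assumes conv: "convex_on UNIV \<psi>" and nonneg: "\<And>r. 0 \<le> \<psi> r" and diff: "\<And>r. \<psi> differentiable at r"
    and v: "integrable lborel v" and h: "0 < h"
  shows "ennreal (\<psi> ((LINT r:{t<..t+h}|lborel. v r) / h)) \<le>
    ennreal (1 / h) * (\<integral>\<^sup>+r. ennreal (\<psi> (v r)) * indicator {t<..t+h} r \<partial>lborel)"
proof -
  let ?A = "{t<..t+h}"
  define m where "m = (LINT r:?A|lborel. v r) / h"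
  obtain c where "(\<psi> has_real_derivative c) (at m)"
    using diff real_differentiable_def by blast
  then have tangent: "\<psi> x \<ge> \<psi> m + c * (x - m)" for x
    using convex_on_imp_above_tangent[OF conv, of m x c] by simp
  have \<psi>_cont: "continuous_on UNIV \<psi>"
    using diff by (meson continuous_at_imp_continuous_on differentiable_imp_continuous_within)
  have [measurable]: "v \<in> borel_measurable borel" using v by (auto dest: borel_measurable_integrable)
  have [measurable]: "\<psi> \<in> borel_measurable borel"
    using \<psi>_cont by (rule borel_measurable_continuous_onI)
  show ?thesis
  \<comment> \<open>If the right-hand side is infinite there is nothing to prove; otherwise \<psi>
    along \<open>v\<close> is integrable on the interval and real-valued integrals can be
    compared.\<close>
  proof (cases "(\<integral>\<^sup>+r. ennreal (\<psi> (v r)) * indicator ?A r \<partial>lborel) = top")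
    case True
    then show ?thesis using h by (simp add: ennreal_mult_top)
  next
    case False
    then have fin: "(\<integral>\<^sup>+r. ennreal (\<psi> (v r)) * indicator ?A r \<partial>lborel) < \<infinity>"
      by (simp add: less_top)
    have eq: "ennreal (\<psi> (v r)) * indicator ?A r = ennreal (indicator ?A r * \<psi> (v r))" for r
      by (auto simp: indicator_def)
    have int: "integrable lborel (\<lambda>r. indicator ?A r * \<psi> (v r))"
      using fin nonneg unfolding eq by (intro integrableI_nonneg) auto
    have intv: "integrable lborel (\<lambda>r. indicator ?A r * v r)"
      using integrable_mult_indicator[of ?A lborel v] v by simp
    have int1: "integrable lborel (indicator ?A :: real \<Rightarrow> real)"
      using h by (intro integrable_real_indicator) auto
    have "h * \<psi> m = (\<integral>r. (\<psi> m - c * m) * indicator ?A r + c * (indicator ?A r * v r) \<partial>lborel)"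
      using h int1 intv by (simp add: m_def set_lebesgue_integral_def field_simps)
    also have "\<dots> \<le> (\<integral>r. indicator ?A r * \<psi> (v r) \<partial>lborel)"
    proof (rule integral_mono)
      show "integrable lborel (\<lambda>r. (\<psi> m - c * m) * indicator ?A r + c * (indicator ?A r * v r))"
        using int1 intv by (intro Bochner_Integration.integrable_add integrable_mult_right)
      show "(\<psi> m - c * m) * indicator ?A r + c * (indicator ?A r * v r) \<le> indicator ?A r * \<psi> (v r)" for r
        using tangent[of "v r"] by (auto simp: indicator_def algebra_simps)
    qed (rule int)
    finally have "\<psi> m \<le> 1 / h * (\<integral>r. indicator ?A r * \<psi> (v r) \<partial>lborel)"
      using h by (simp add: field_simps)
    then have "ennreal (\<psi> m) \<le> ennreal (1 / h) * ennreal (\<integral>r. indicator ?A r * \<psi> (v r) \<partial>lborel)"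
      using h by (simp add: ennreal_mult'[symmetric] ennreal_leI)
    also have "ennreal (\<integral>r. indicator ?A r * \<psi> (v r) \<partial>lborel) = (\<integral>\<^sup>+r. ennreal (\<psi> (v r)) * indicator ?A r \<partial>lborel)"
      unfolding eq using int nonneg by (intro nn_integral_eq_integral[symmetric]) auto
    finally show ?thesis by (simp add: m_def)
  qed
qed

text \<open>Jensen's inequality holds for each \<open>t\<close>. After interchanging the integrals,
  each \<open>r\<close> is counted for those \<open>t\<close> with t < r \<le> t + h, a set of
  length \<open>h\<close>, which cancels the factor 1/h.\<close>

lemma Jensen_sliding:
  fixes \<psi> v :: "real \<Rightarrow> real"
  assumes conv: "convex_on UNIV \<psi>" and nonneg: "\<And>r. 0 \<le> \<psi> r" and diff: "\<And>r. \<psi> differentiable at r"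
    and v: "integrable lborel v" and h: "0 < h"
  shows "(\<integral>\<^sup>+t. ennreal (\<psi> ((primitive v (t + h) - primitive v t) / h)) \<partial>lborel)
    \<le> (\<integral>\<^sup>+t. ennreal (\<psi> (v t)) \<partial>lborel)"
proof -
  have \<psi>_cont: "continuous_on UNIV \<psi>"
    using diff by (meson continuous_at_imp_continuous_on differentiable_imp_continuous_within)
  have [measurable]: "v \<in> borel_measurable borel" using v by (auto dest: borel_measurable_integrable)
  have [measurable]: "\<psi> \<in> borel_measurable borel"
    using \<psi>_cont by (rule borel_measurable_continuous_onI)
  \<comment> \<open>The window is written as a condition on the pair (t, r): it is jointly
    measurable and reads as an interval in either variable.\<close>
  let ?g = "\<lambda>t r. ennreal (\<psi> (v r)) * (if t < r \<and> r \<le> t + h then 1 else 0)"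
  have "(\<integral>\<^sup>+t. ennreal (\<psi> ((primitive v (t + h) - primitive v t) / h)) \<partial>lborel)
      \<le> (\<integral>\<^sup>+t. ennreal (1 / h) * (\<integral>\<^sup>+r. ?g t r \<partial>lborel) \<partial>lborel)"
  proof (rule nn_integral_mono)
    fix t
    have "(\<integral>\<^sup>+r. ennreal (\<psi> (v r)) * indicator {t<..t+h} r \<partial>lborel) = (\<integral>\<^sup>+r. ?g t r \<partial>lborel)"
      by (intro nn_integral_cong) (auto simp: indicator_def)
    then show "ennreal (\<psi> ((primitive v (t + h) - primitive v t) / h)) \<le> ennreal (1 / h) * (\<integral>\<^sup>+r. ?g t r \<partial>lborel)"
      using Jensen_interval[OF conv nonneg diff v h, of t] primitive_diff[OF v, of t "t + h"] h by simp
  qed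
  also have "\<dots> = ennreal (1 / h) * (\<integral>\<^sup>+t. (\<integral>\<^sup>+r. ?g t r \<partial>lborel) \<partial>lborel)"
    by (intro nn_integral_cmult) measurable
  also have "(\<integral>\<^sup>+t. (\<integral>\<^sup>+r. ?g t r \<partial>lborel) \<partial>lborel) = (\<integral>\<^sup>+r. (\<integral>\<^sup>+t. ?g t r \<partial>lborel) \<partial>lborel)"
    by (intro lborel_pair.Fubini'[symmetric]) measurable
  also have "\<dots> = (\<integral>\<^sup>+r. ennreal (\<psi> (v r)) * ennreal h \<partial>lborel)"
  proof (intro nn_integral_cong)
    fix r
    have "(\<integral>\<^sup>+t. ?g t r \<partial>lborel) = (\<integral>\<^sup>+t. ennreal (\<psi> (v r)) * indicator {r-h..<r} t \<partial>lborel)"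
      by (intro nn_integral_cong) (auto simp: indicator_def)
    also have "\<dots> = ennreal (\<psi> (v r)) * emeasure lborel {r-h..<r}"
      by (intro nn_integral_cmult_indicator) auto
    finally show "(\<integral>\<^sup>+t. ?g t r \<partial>lborel) = ennreal (\<psi> (v r)) * ennreal h" using h by simp
  qed
  also have "\<dots> = (\<integral>\<^sup>+r. ennreal (\<psi> (v r)) \<partial>lborel) * ennreal h"
    by (intro nn_integral_multc) measurable
  also have "ennreal (1 / h) * \<dots> = (\<integral>\<^sup>+r. ennreal (\<psi> (v r)) \<partial>lborel)"
    using h by (simp add: mult.commute[of _ "ennreal h"] mult.assoc[symmetric] ennreal_mult'[symmetric])
  finally show ?thesis .
qed

text \<open>Where |r| exceeds \<open>L\<close>, one factor |r| is kept and the remaining power p - 1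
  is bounded below by its value at \<open>L\<close>.\<close>

lemma superlinear_bound:
  fixes r :: real
  assumes growth: "\<And>r. \<bar>r\<bar> \<ge> R \<Longrightarrow> \<psi> r \<ge> C * \<bar>r\<bar> powr p" and nonneg: "\<And>r. 0 \<le> \<psi> r"
    and "1 < p" "0 < C" "0 < R" "R \<le> L"
  shows "\<bar>r\<bar> \<le> L + \<psi> r / (C * L powr (p - 1))"
proof (cases "\<bar>r\<bar> \<le> L")
  case True
  then show ?thesis using nonneg[of r] assms by (simp add: add_increasing2)
next
  case False
  have "\<bar>r\<bar> powr p = \<bar>r\<bar> * \<bar>r\<bar> powr (p - 1)"
    using False assms powr_mult_base[of "\<bar>r\<bar>" "p - 1"] by simp
  moreover have "L powr (p - 1) \<le> \<bar>r\<bar> powr (p - 1)" using False assms by (intro powr_mono2) auto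
  ultimately have "C * (\<bar>r\<bar> * L powr (p - 1)) \<le> C * \<bar>r\<bar> powr p"
    using assms by (intro mult_left_mono) (auto intro: mult_left_mono)
  also have "\<dots> \<le> \<psi> r" using growth[of r] False assms by auto
  finally have "\<bar>r\<bar> \<le> \<psi> r / (C * L powr (p - 1))"
    using assms by (simp add: field_simps)
  then show ?thesis using assms by simp
qed

text \<open>A quantitative de la Vallee-Poussin criterion. \<open>L\<close> depends on
  \<open>M\<close> and \<open>e\<close> but not on \<open>v\<close> or \<open>A\<close>; the same
  estimate later yields equicontinuity, with one interval as \<open>A\<close>, and absolute
  continuity, with a finite union.\<close>

lemma uniform_integrability:
  fixes \<psi> :: "real \<Rightarrow> real"
  assumes growth: "\<And>r. \<bar>r\<bar> \<ge> R \<Longrightarrow> \<psi> r \<ge> C * \<bar>r\<bar> powr p" and nonneg: "\<And>r. 0 \<le> \<psi> r"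
    and meas: "\<psi> \<in> borel_measurable borel"
    and "1 < p" "0 < C" "0 < R" "0 \<le> M" "0 < e"
  obtains L where "0 < L"
    "\<And>(v :: real \<Rightarrow> real) A. integrable lborel v \<Longrightarrow> (\<integral>\<^sup>+t. ennreal (\<psi> (v t)) \<partial>lborel) \<le> ennreal M \<Longrightarrow>
       A \<in> sets borel \<Longrightarrow> emeasure lborel A < \<infinity> \<Longrightarrow>
       (LINT r:A|lborel. \<bar>v r\<bar>) \<le> L * measure lborel A + e"
proof -
  \<comment> \<open>The second entry of the maximum solves M / (C L^(p-1)) = e, so the part of the
    control above \<open>L\<close> contributes at most \<open>e\<close>.\<close>
  define L where "L = max R ((M / (C * e)) powr (1 / (p - 1)))"
  have L: "R \<le> L" "0 < L" using assms by (auto simp: L_def)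
  have "M / (C * e) = ((M / (C * e)) powr (1 / (p - 1))) powr (p - 1)"
    using assms by (simp add: powr_powr)
  also have "\<dots> \<le> L powr (p - 1)" using assms by (intro powr_mono2) (auto simp: L_def)
  finally have small: "M / (C * L powr (p - 1)) \<le> e" using assms L by (simp add: field_simps)
  define k where "k = 1 / (C * L powr (p - 1))"
  have c: "0 < k" using assms L by (simp add: k_def)
  show thesis
  proof (rule that[OF L(2)])
    fix v :: "real \<Rightarrow> real" and A :: "real set" assume v: "integrable lborel v" "(\<integral>\<^sup>+t. ennreal (\<psi> (v t)) \<partial>lborel) \<le> ennreal M"
      and A: "A \<in> sets borel" "emeasure lborel A < \<infinity>"
    note [measurable] = meas A(1)
    have [measurable]: "v \<in> borel_measurable borel" using v by (auto dest: borel_measurable_integrable)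
    have int: "integrable lborel (\<lambda>r. indicator A r * \<bar>v r\<bar>)"
      using integrable_mult_indicator[of A lborel "\<lambda>r. \<bar>v r\<bar>"] v A by simp
    have "ennreal (LINT r:A|lborel. \<bar>v r\<bar>) = (\<integral>\<^sup>+r. ennreal (indicator A r * \<bar>v r\<bar>) \<partial>lborel)"
      unfolding set_lebesgue_integral_def real_scaleR_def
      using int by (intro nn_integral_eq_integral[symmetric]) auto
    also have "\<dots> \<le> (\<integral>\<^sup>+r. ennreal L * indicator A r + ennreal k * ennreal (\<psi> (v r)) \<partial>lborel)"
    proof (rule nn_integral_mono)
      fix r
      have "\<bar>v r\<bar> \<le> L + k * \<psi> (v r)"
        using superlinear_bound[where \<psi> = \<psi> and r = "v r" and L = L, OF growth nonneg] assms L by (simp add: k_def)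
      then have "indicator A r * \<bar>v r\<bar> \<le> L * indicator A r + k * \<psi> (v r)"
        using c nonneg[of "v r"] by (auto simp: indicator_def)
      then have "ennreal (indicator A r * \<bar>v r\<bar>) \<le> ennreal (L * indicator A r + k * \<psi> (v r))"
        by (rule ennreal_leI)
      also have "\<dots> = ennreal L * indicator A r + ennreal k * ennreal (\<psi> (v r))"
        using c nonneg[of "v r"] L by (auto simp: ennreal_plus ennreal_mult' indicator_def)
      finally show "ennreal (indicator A r * \<bar>v r\<bar>) \<le> ennreal L * indicator A r + ennreal k * ennreal (\<psi> (v r))" .
    qed
    also have "\<dots> = ennreal L * emeasure lborel A + ennreal k * (\<integral>\<^sup>+r. ennreal (\<psi> (v r)) \<partial>lborel)"
      by (subst nn_integral_add) (auto simp: nn_integral_cmult nn_integral_cmult_indicator)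
    also have "\<dots> \<le> ennreal L * ennreal (measure lborel A) + ennreal k * ennreal M"
      using v(2) A by (intro add_mono mult_left_mono) (auto simp: emeasure_eq_ennreal_measure)
    also have "\<dots> = ennreal (L * measure lborel A + k * M)"
      using L c assms by (simp add: ennreal_mult'[symmetric] ennreal_plus[symmetric] del: ennreal_plus)
    finally have "(LINT r:A|lborel. \<bar>v r\<bar>) \<le> L * measure lborel A + k * M"
      using L c assms by (subst (asm) ennreal_le_iff) auto
    then show "(LINT r:A|lborel. \<bar>v r\<bar>) \<le> L * measure lborel A + e" using small by (simp add: k_def)
  qed
qed

text \<open>The increments over disjoint intervals are collected into one integral over their union,
  to which the integrability bound is applied once; thus \<open>e\<close> appears once and not
  \<open>n\<close> times.\<close>

lemma primitive_sum_le:
  assumes v: "integrable lborel v"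
    and ab: "\<forall>k<(n::nat). a k \<le> b k" and disj: "disjoint_family_on (\<lambda>k. {a k<..<b k}) {..<n}"
    and bound: "\<And>A. A \<in> sets borel \<Longrightarrow> emeasure lborel A < \<infinity> \<Longrightarrow>
       (LINT r:A|lborel. \<bar>v r\<bar>) \<le> L * measure lborel A + e"
  shows "(\<Sum>k<n. \<bar>primitive v (b k) - primitive v (a k)\<bar>) \<le> L * (\<Sum>k<n. b k - a k) + e"
proof -
  let ?A = "\<Union>k<n. {a k<..b k}"
  have disj': "disjoint_family_on (\<lambda>k. {a k<..b k}) {..<n}"
    unfolding disjoint_family_on_def
  proof (intro ballI impI)
    fix i j assume ij: "i \<in> {..<n}" "j \<in> {..<n}" "i \<noteq> j"
    show "{a i<..b i} \<inter> {a j<..b j} = {}"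
    proof (rule ccontr)
      assume "{a i<..b i} \<inter> {a j<..b j} \<noteq> {}"
      then obtain x where "x \<in> {a i<..b i} \<inter> {a j<..b j}" by blast
      then have x: "a i < x" "x \<le> b i" "a j < x" "x \<le> b j" by auto
      \<comment> \<open>Only the open intervals are assumed disjoint. A common point of two
        half-open ones can be moved slightly to the left into both open ones.\<close>
      then obtain y where "max (a i) (a j) < y" "y < x" using dense[of "max (a i) (a j)" x] by auto
      with x have "y \<in> {a i<..<b i} \<inter> {a j<..<b j}" by auto
      with disj ij show False by (auto simp: disjoint_family_on_def)
    qed
  qed
  have fin: "emeasure lborel ?A < \<infinity>"
  proof -
    have "bounded ?A" by (intro bounded_UN) auto
    then show ?thesis by (rule emeasure_bounded_finite)
  qed
  have "(\<Sum>k<n. \<bar>primitive v (b k) - primitive v (a k)\<bar>) \<le> (\<Sum>k<n. LINT r:{a k<..b k}|lborel. \<bar>v r\<bar>)"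
    using ab by (intro sum_mono primitive_diff_le v) auto
  also have "\<dots> = (LINT r:?A|lborel. \<bar>v r\<bar>)"
  proof (rule set_integral_finite_Union[symmetric])
    show "set_integrable lborel {a i<..b i} (\<lambda>r. \<bar>v r\<bar>)" if "i \<in> {..<n}" for i
      unfolding set_integrable_def using v by (intro integrable_mult_indicator) auto
  qed (use disj' in auto)
  also have "\<dots> \<le> L * measure lborel ?A + e" using fin by (intro bound) auto
  also have "measure lborel ?A = (\<Sum>k<n. measure lborel {a k<..b k})"
    using disj' ab by (intro measure_finite_Union) auto
  also have "\<dots> = (\<Sum>k<n. b k - a k)" using ab by (intro sum.cong) auto
  finally show ?thesis .
qed

section \<open>Trajectories and curvature profiles\<close>

lemma primitive_eq_integral:
  assumes "integrable lborel v" "a \<le> t"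
  shows "v integrable_on {a..t}" "primitive v t = primitive v a + integral {a..t} v"
proof -
  have int: "set_integrable lborel A v" if "A \<in> sets borel" for A
    unfolding set_integrable_def using assms(1) that by (intro integrable_mult_indicator) auto
  show "v integrable_on {a..t}" by (intro set_borel_integral_eq_integral int) simp
  have "(LINT r:{a<..t}|lborel. v r) = (LINT r:{a..t}|lborel. v r)"
    unfolding set_lebesgue_integral_def
  proof (intro integral_cong_AE)
    show "AE x in lborel. indicat_real {a<..t} x *\<^sub>R v x = indicat_real {a..t} x *\<^sub>R v x"
      using AE_lborel_singleton[of a] by eventually_elim (auto simp: indicator_def)
  qed (use assms(1) in \<open>auto dest: borel_measurable_integrable\<close>)
  also have "\<dots> = integral {a..t} v" by (intro set_borel_integral_eq_integral int) simp
  finally show "primitive v t = primitive v a + integral {a..t} v"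
    using primitive_diff[OF assms] by simp
qed

lemma primitive_continuous:
  assumes "integrable lborel v"
  shows "continuous_on A (primitive v)"
proof -
  have "isCont (primitive v) t" for t
  proof -
    have "continuous_on {t - 1..t + 1} (\<lambda>s. primitive v (t - 1) + integral {t - 1..s} v)"
      by (intro continuous_intros indefinite_integral_continuous_1 primitive_eq_integral assms) auto
    then have "continuous_on {t - 1..t + 1} (primitive v)"
      by (rule continuous_on_eq) (auto simp: primitive_eq_integral(2)[OF assms])
    then show ?thesis by (rule continuous_on_interior) simp
  qed
  then show ?thesis by (simp add: continuous_at_imp_continuous_on)
qed

text \<open>The angle \<open>\<theta>0\<close> and the target angle are fixed lifts; a curvature profile reaches the target
  when its heading arrives at some lift of the target angle.\<close>

definition heading :: "real \<Rightarrow> (real \<Rightarrow> real) \<Rightarrow> real \<Rightarrow> real" where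
  "heading \<theta>0 K t = \<theta>0 + integral {0..t} K"

definition reaches :: "state \<Rightarrow> state \<Rightarrow> real \<Rightarrow> (real \<Rightarrow> real) \<Rightarrow> bool" where
  "reaches X0 X1 T K \<longleftrightarrow> (case X0 of (x0, y0, c0, k0) \<Rightarrow> case X1 of (x1, y1, c1, k1) \<Rightarrow>
     K 0 = k0 \<and> K T = k1 \<and>
     (\<exists>j::int. heading (rep_circle c0) K T = rep_circle c1 + 2 * pi * of_int j) \<and>
     integral {0..T} (\<lambda>t. cos (heading (rep_circle c0) K t)) = x1 - x0 \<and>
     integral {0..T} (\<lambda>t. sin (heading (rep_circle c0) K t)) = y1 - y0)"

lemma proj_circle_eq_iff: "proj_circle a = proj_circle b \<longleftrightarrow> (\<exists>j::int. a - b = 2 * pi * of_int j)"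
  by (rule circle.abs_eq_iff)

lemma heading_continuous:
  assumes "continuous_on {0..T} K"
  shows "continuous_on {0..T} (heading \<theta>0 K)"
  unfolding heading_def using assms
  by (intro continuous_intros indefinite_integral_continuous_1 integrable_continuous_real)

lemma indefinite_integral_ramp:
  assumes g: "continuous_on {0..T} g" and T: "0 < T"
  obtains L where "ramp T L S (\<lambda>t. c + integral {0..t} g) g"
proof -
  have "bounded (g ` {0..T})" by (intro compact_imp_bounded compact_continuous_image g) simp
  then obtain L where L: "\<And>t. t \<in> {0..T} \<Longrightarrow> \<bar>g t\<bar> \<le> L" by (fastforce simp: bounded_iff)
  show thesis
  proof (rule that[of L], rule ramp_continuous_deriv)
    show "continuous_on {0..T} (\<lambda>t. c + integral {0..t} g)"
      by (intro continuous_intros indefinite_integral_continuous_1 integrable_continuous_real g)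
    show "((\<lambda>t. c + integral {0..t} g) has_real_derivative g t) (at t)" if "0 < t" "t < T" for t
      using integral_has_real_derivative[OF g, of t] that at_within_Icc_at[of 0 t T]
      by (auto intro!: derivative_eq_intros)
    show "\<bar>g t\<bar> \<le> L" if "0 < t" "t < T" for t using L that by auto
  qed
qed

text \<open>Angle and position are recovered from the curvature by integration. Their integrands are
  continuous, so they are differentiable at every interior time, and only the equation for the
  curvature itself is an almost everywhere hypothesis.\<close>

lemma admissible_of_reaches:
  assumes T: "0 < T" and u: "u \<in> borel_measurable borel"
    and up: "integrable (lebesgue_on {0..T}) (\<lambda>t. \<bar>u t\<bar> powr p)"
    and K: "absolutely_cont 0 T K"
    and K': "AE t in lebesgue_on {0..T}. (K has_real_derivative u t) (at t within {0..T})"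
    and reach: "reaches X0 X1 T K"
  obtains X where "admissible p X0 X1 T u X" "\<And>t. t \<in> {0..T} \<Longrightarrow> curvature (X t) = K t"
proof -
  obtain x0 y0 c0 k0 where X0: "X0 = (x0, y0, c0, k0)" by (cases X0)
  obtain x1 y1 c1 k1 where X1: "X1 = (x1, y1, c1, k1)" by (cases X1)
  define \<theta> where "\<theta> = heading (rep_circle c0) K"
  define x where "x t = x0 + integral {0..t} (\<lambda>s. cos (\<theta> s))" for t
  define y where "y t = y0 + integral {0..t} (\<lambda>s. sin (\<theta> s))" for t
  define X where "X t = (x t, y t, proj_circle (\<theta> t), K t)" for t
  have K_cont: "continuous_on {0..T} K" by (rule absolutely_cont_continuous_on[OF K])
  then have \<theta>_cont: "continuous_on {0..T} \<theta>" unfolding \<theta>_def by (rule heading_continuous)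
  obtain L1 where \<theta>: "ramp T L1 {} \<theta> K"
    using indefinite_integral_ramp[OF K_cont T] unfolding \<theta>_def heading_def[abs_def] by blast
  obtain L2 where x: "ramp T L2 {} x (\<lambda>t. cos (\<theta> t))"
    using indefinite_integral_ramp[OF continuous_on_cos[OF \<theta>_cont] T] unfolding x_def[abs_def] by blast
  obtain L3 where y: "ramp T L3 {} y (\<lambda>t. sin (\<theta> t))"
    using indefinite_integral_ramp[OF continuous_on_sin[OF \<theta>_cont] T] unfolding y_def[abs_def] by blast
  have "AE t in lebesgue. t \<notin> {0, T}"
    by (intro AE_not_in) (auto simp: negligible_iff_null_sets[symmetric] negligible_finite)
  then have "AE t in lebesgue_on {0..T}. t \<notin> {0, T}"
    by (subst AE_restrict_space_iff) auto
  moreover have "AE t in lebesgue_on {0..T}. t \<in> {0..T}" by (rule AE_I2) simp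
  ultimately have "AE t in lebesgue_on {0..T}.
           (x has_real_derivative cos (\<theta> t)) (at t within {0..T}) \<and>
           (y has_real_derivative sin (\<theta> t)) (at t within {0..T}) \<and>
           (\<theta> has_real_derivative K t) (at t within {0..T}) \<and>
           (K has_real_derivative u t) (at t within {0..T})"
    using K'
  proof eventually_elim
    case (elim t)
    then have "t \<in> {0<..<T} - {}" by auto
    then show ?case using x y \<theta> elim by (auto simp: ramp_def intro: has_field_derivative_at_within)
  qed
  then have "trajectory T u X"
    unfolding trajectory_def
    using K ramp_absolutely_cont[OF x] ramp_absolutely_cont[OF y] ramp_absolutely_cont[OF \<theta>]
    by (intro exI[of _ x] exI[of _ y] exI[of _ \<theta>] exI[of _ K]) (auto simp: X_def)
  moreover have "control p T u"
    using T up u by (auto simp: control_def intro!: measurable_restrict_space1 measurable_completion)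
  moreover have "X 0 = X0"
    using reach by (simp add: X_def X0 X1 reaches_def x_def y_def \<theta>_def heading_def proj_rep_circle)
  moreover have "X T = X1"
  proof -
    have "\<exists>j::int. \<theta> T - rep_circle c1 = 2 * pi * of_int j"
      using reach by (auto simp: X0 X1 reaches_def \<theta>_def)
    then have "proj_circle (\<theta> T) = c1"
      using proj_circle_eq_iff[of "\<theta> T" "rep_circle c1"] by (simp add: proj_rep_circle)
    then show ?thesis
      using reach by (simp add: X_def X0 X1 reaches_def x_def y_def \<theta>_def)
  qed
  ultimately have "admissible p X0 X1 T u X" by (simp add: admissible_def)
  then show thesis by (rule that) (simp add: X_def curvature_def)
qed

text \<open>Replaces a competitor by data on the whole line: a Borel control vanishing off [0, T]
  whose primitive is the curvature up to a constant. The cost becomes one integral over the line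
  because \<psi>(0) = 0.\<close>

lemma reaches_of_admissible:
  fixes \<phi> \<psi> :: "real \<Rightarrow> real"
  assumes adm: "admissible p X0 X1 T u X" and p: "1 < p" and \<psi>0: "\<psi> 0 = 0"
  obtains v where "v \<in> borel_measurable borel" "integrable lborel v" "\<And>t. t \<notin> {0..T} \<Longrightarrow> v t = 0"
    "reaches X0 X1 T (\<lambda>t. curvature X0 + primitive v t)"
    "cost \<phi> \<psi> T u X = (\<integral>\<^sup>+t. ennreal (indicator {0..T} t *
        (1 + \<phi> (curvature X0 + primitive v t)) + \<psi> (v t)) \<partial>lborel)"
proof -
  obtain x0 y0 c0 k0 where X0: "X0 = (x0, y0, c0, k0)" by (cases X0)
  obtain x1 y1 c1 k1 where X1: "X1 = (x1, y1, c1, k1)" by (cases X1)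
  have T: "0 < T" and u: "u \<in> borel_measurable (lebesgue_on {0..T})"
    and up: "integrable (lebesgue_on {0..T}) (\<lambda>t. \<bar>u t\<bar> powr p)"
    and ends: "X 0 = X0" "X T = X1" and "trajectory T u X"
    using adm by (auto simp: admissible_def control_def)
  then obtain x y \<theta> \<kappa> where
     X: "\<And>t. t \<in> {0..T} \<Longrightarrow> X t = (x t, y t, proj_circle (\<theta> t), \<kappa> t)" and
     AC: "absolutely_cont 0 T x" "absolutely_cont 0 T y" "absolutely_cont 0 T \<theta>" "absolutely_cont 0 T \<kappa>" and
     deriv: "AE t in lebesgue_on {0..T}.
           (x has_real_derivative cos (\<theta> t)) (at t within {0..T}) \<and>
           (y has_real_derivative sin (\<theta> t)) (at t within {0..T}) \<and>
           (\<theta> has_real_derivative \<kappa> t) (at t within {0..T}) \<and>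
           (\<kappa> has_real_derivative u t) (at t within {0..T})"
    unfolding trajectory_def by blast
  \<comment> \<open>The control is only Lebesgue measurable on [0, T]. It is extended by 0 and then
    changed on a null set to a Borel function, for which the results on primitives are
    stated.\<close>
  define u0 where "u0 t = (if t \<in> {0..T} then u t else 0)" for t
  have u0: "u0 \<in> borel_measurable lebesgue"
    unfolding u0_def using u by (subst borel_measurable_if) auto
  then obtain v0 where v0: "v0 \<in> borel_measurable lborel" "AE t in lborel. u0 t = v0 t"
    using completion_ex_borel_measurable_real by blast
  define v where "v t = (if t \<in> {0..T} then v0 t else 0)" for t
  have v [measurable]: "v \<in> borel_measurable borel" using v0(1) unfolding v_def by measurable
  have "AE t in lborel. u0 t = v t"
    using v0(2) by eventually_elim (auto simp: v_def u0_def)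
  then have vu: "AE t in lebesgue. u0 t = v t" by (rule AE_completion)
  have v_out: "v t = 0" if "t \<notin> {0..T}" for t using that by (auto simp: v_def)
  have int_v: "integrable lborel v"
  proof -
    have up': "integrable lebesgue (\<lambda>t. indicator {0..T} t * \<bar>u t\<bar> powr p)"
      using up by (subst (asm) integrable_restrict_space) auto
    have "integrable lebesgue (\<lambda>t. indicat_real {0..T} t + indicator {0..T} t * \<bar>u t\<bar> powr p)"
      using up' by (intro Bochner_Integration.integrable_add integrable_real_indicator)
        (auto simp: emeasure_lborel_Icc_eq)
    then have "integrable lebesgue v"
    proof (rule Bochner_Integration.integrable_bound)
      show "v \<in> borel_measurable lebesgue" using v by (intro measurable_completion) simp
      \<comment> \<open>On a bounded time interval p-integrability implies integrability, since |r|
        \<le> 1 + |r|^p.\<close>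
      have bound: "\<bar>r\<bar> \<le> 1 + \<bar>r\<bar> powr p" for r :: real
      proof (cases "\<bar>r\<bar> \<le> 1")
        case False
        then have "\<bar>r\<bar> powr 1 \<le> \<bar>r\<bar> powr p" using p by (intro powr_mono) auto
        then show ?thesis by simp
      qed (simp add: add_increasing2)
      show "AE t in lebesgue. norm (v t) \<le> norm (indicat_real {0..T} t + indicator {0..T} t * \<bar>u t\<bar> powr p)"
        using vu
      proof eventually_elim
        case (elim t)
        then show ?case using bound[of "u t"] v_out[of t]
          by (cases "t \<in> {0..T}") (auto simp: u0_def)
      qed
    qed
    then show ?thesis using v by (simp add: integrable_completion)
  qed
  have ftc: "(g has_integral (f t - f 0)) {0..t}"
    if "absolutely_cont 0 T f" "AE t in lebesgue_on {0..T}. (f has_real_derivative g t) (at t within {0..T})"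
      "t \<in> {0..T}" for f g t
  proof (rule absolutely_cont_has_integral)
    show "absolutely_cont 0 t f" by (rule absolutely_cont_subset[OF that(1)]) (use that in auto)
    have "AE s in lebesgue. s \<in> {0..T} \<longrightarrow> (f has_real_derivative g s) (at s within {0..T})"
      using that(2) by (subst (asm) AE_restrict_space_iff) auto
    then have "AE s in lebesgue. s \<in> {0..t} \<longrightarrow> (f has_real_derivative g s) (at s within {0..t})"
    proof eventually_elim
      case (elim s)
      then show ?case using that(3)
        by (auto intro: has_field_derivative_subset[of f "g s" s "{0..T}"])
    qed
    then show "AE s in lebesgue_on {0..t}. (f has_real_derivative g s) (at s within {0..t})"
      by (subst AE_restrict_space_iff) auto
  qed (use that in auto)
  define K where "K t = k0 + primitive v t" for t
  have \<kappa>0: "\<kappa> 0 = k0" "proj_circle (\<theta> 0) = c0" "x 0 = x0" "y 0 = y0"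
    using X[of 0] ends T by (auto simp: X0)
  have \<kappa>T: "\<kappa> T = k1" "proj_circle (\<theta> T) = c1" "x T = x1" "y T = y1"
    using X[of T] ends T by (auto simp: X1)
  have K: "\<kappa> t = K t" if "t \<in> {0..T}" for t
  proof -
    have "(u has_integral (\<kappa> t - \<kappa> 0)) {0..t}"
      using deriv by (intro ftc AC that) (auto elim: eventually_mono)
    moreover have "{t. u0 t \<noteq> v t} \<in> null_sets lebesgue"
      using vu by (simp add: AE_iff_null_sets completion.AE_iff_null_sets)
    then have "negligible {t. u0 t \<noteq> v t}" by (simp add: negligible_iff_null_sets)
    ultimately have "(v has_integral (\<kappa> t - \<kappa> 0)) {0..t}"
      by (rule has_integral_spike[rotated 2]) (use that in \<open>auto simp: u0_def\<close>)
    then have "integral {0..t} v = \<kappa> t - \<kappa> 0" by (rule integral_unique)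
    moreover have "primitive v t = primitive v 0 + integral {0..t} v"
      using primitive_eq_integral(2)[OF int_v, of 0 t] that by simp
    moreover have "primitive v 0 = 0" by (rule primitive_eq_0) (use v_out in auto)
    ultimately show ?thesis by (simp add: K_def \<kappa>0)
  qed
  \<comment> \<open>The lift supplied by the trajectory need not start at the fixed representative;
    the two differ by a constant multiple of 2 pi, which cosine and sine do not see.\<close>
  obtain j :: int where j: "\<theta> 0 = rep_circle c0 + 2 * pi * of_int j"
    using \<kappa>0(2) proj_circle_eq_iff[of "\<theta> 0" "rep_circle c0"] by (auto simp: proj_rep_circle algebra_simps)
  have head: "heading (rep_circle c0) K t = \<theta> t - 2 * pi * of_int j" if "t \<in> {0..T}" for t
  proof -
    have "(\<kappa> has_integral (\<theta> t - \<theta> 0)) {0..t}"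
      using deriv by (intro ftc AC that) (auto elim: eventually_mono)
    then have "(K has_integral (\<theta> t - \<theta> 0)) {0..t}"
      by (rule has_integral_eq[rotated]) (use K that in auto)
    then show ?thesis by (simp add: heading_def integral_unique j)
  qed
  have trig: "cos (heading (rep_circle c0) K t) = cos (\<theta> t)" "sin (heading (rep_circle c0) K t) = sin (\<theta> t)"
    if "t \<in> {0..T}" for t
    using head[OF that] cos.minus_of_int[of "\<theta> t" j] sin.minus_of_int[of "\<theta> t" j] by (simp_all add: mult.commute)
  have "integral {0..T} (\<lambda>t. cos (heading (rep_circle c0) K t)) = x1 - x0"
  proof -
    have "((\<lambda>t. cos (\<theta> t)) has_integral (x T - x 0)) {0..T}"
      using deriv T by (intro ftc AC) (auto elim: eventually_mono)
    then have "((\<lambda>t. cos (heading (rep_circle c0) K t)) has_integral (x T - x 0)) {0..T}"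
      by (rule has_integral_eq[rotated]) (use trig in auto)
    then show ?thesis using \<kappa>0 \<kappa>T by (simp add: integral_unique)
  qed
  moreover have "integral {0..T} (\<lambda>t. sin (heading (rep_circle c0) K t)) = y1 - y0"
  proof -
    have "((\<lambda>t. sin (\<theta> t)) has_integral (y T - y 0)) {0..T}"
      using deriv T by (intro ftc AC) (auto elim: eventually_mono)
    then have "((\<lambda>t. sin (heading (rep_circle c0) K t)) has_integral (y T - y 0)) {0..T}"
      by (rule has_integral_eq[rotated]) (use trig in auto)
    then show ?thesis using \<kappa>0 \<kappa>T by (simp add: integral_unique)
  qed
  moreover have "\<exists>i::int. heading (rep_circle c0) K T = rep_circle c1 + 2 * pi * of_int i"
  proof -
    obtain i :: int where "\<theta> T - rep_circle c1 = 2 * pi * of_int i"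
      using \<kappa>T(2) proj_circle_eq_iff[of "\<theta> T" "rep_circle c1"] by (auto simp: proj_rep_circle)
    then show ?thesis using head[of T] T by (intro exI[of _ "i - j"]) (simp add: algebra_simps)
  qed
  ultimately have reach: "reaches X0 X1 T K"
    using K[of 0] K[of T] T \<kappa>0 \<kappa>T by (simp add: reaches_def X0 X1)
  have "cost \<phi> \<psi> T u X = (\<integral>\<^sup>+t. ennreal (1 + \<phi> (curvature (X t)) + \<psi> (u t)) * indicator {0..T} t \<partial>lebesgue)"
    unfolding cost_def by (subst nn_integral_restrict_space) auto
  also have "\<dots> = (\<integral>\<^sup>+t. ennreal (indicator {0..T} t * (1 + \<phi> (K t)) + \<psi> (v t)) \<partial>lebesgue)"
  proof (rule nn_integral_cong_AE)
    show "AE t in lebesgue. ennreal (1 + \<phi> (curvature (X t)) + \<psi> (u t)) * indicator {0..T} t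
      = ennreal (indicator {0..T} t * (1 + \<phi> (K t)) + \<psi> (v t))"
      using vu
    proof eventually_elim
      case (elim t)
      show ?case
      proof (cases "t \<in> {0..T}")
        case True
        then show ?thesis using elim K[OF True] X[OF True] by (simp add: curvature_def u0_def)
      next
        case False
        then show ?thesis by (simp add: v_out \<psi>0 del: atLeastAtMost_iff)
      qed
    qed
  qed
  also have "\<dots> = (\<integral>\<^sup>+t. ennreal (indicator {0..T} t * (1 + \<phi> (K t)) + \<psi> (v t)) \<partial>lborel)"
    by (rule nn_integral_completion)
  finally show thesis
    using that[OF v int_v v_out] reach by (simp add: K_def[abs_def] X0 curvature_def)
qed

section \<open>Limits of curvature profiles\<close>

lemma uniform_limit_indefinite_integral:
  fixes f :: "nat \<Rightarrow> real \<Rightarrow> real"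
  assumes lim: "uniform_limit {0..B} f g sequentially"
    and f: "\<And>n. continuous_on {0..B} (f n)" and g: "continuous_on {0..B} g" and B: "0 \<le> B"
  shows "uniform_limit {0..B} (\<lambda>n t. integral {0..t} (f n)) (\<lambda>t. integral {0..t} g) sequentially"
  unfolding uniform_limit_iff
proof (intro allI impI)
  fix e :: real assume e: "e > 0"
  have "e / (B + 1) > 0" using e B by simp
  then have "\<forall>\<^sub>F n in sequentially. \<forall>t\<in>{0..B}. dist (f n t) (g t) < e / (B + 1)"
    using lim unfolding uniform_limit_iff by blast
  then show "\<forall>\<^sub>F n in sequentially. \<forall>t\<in>{0..B}. dist (integral {0..t} (f n)) (integral {0..t} g) < e"
  proof eventually_elim
    case (elim n)
    show ?case
    proof
      fix t assume t: "t \<in> {0..B}"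
      have sub: "{0..t} \<subseteq> {0..B}" using t by auto
      have cont: "continuous_on {0..t} (f n)" "continuous_on {0..t} g"
        using f g sub continuous_on_subset by blast+
      have "integral {0..t} (f n) - integral {0..t} g = integral {0..t} (\<lambda>s. f n s - g s)"
        using cont by (intro integral_diff[symmetric] integrable_continuous_real)
      moreover have "norm (integral {0..t} (\<lambda>s. f n s - g s)) \<le> e / (B + 1) * (t - 0)"
        using t elim cont
        by (intro integral_bound continuous_intros) (auto simp: dist_real_def intro!: less_imp_le)
      moreover have "e / (B + 1) * t < e"
      proof -
        have "e * t < e * (B + 1)" using t e by (intro mult_strict_left_mono) auto
        then show ?thesis using B by (simp add: field_simps)
      qed
      ultimately show "dist (integral {0..t} (f n)) (integral {0..t} g) < e"
        by (simp add: dist_real_def)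
    qed
  qed
qed

text \<open>The sum-to-product formulas and |sin y| \<le> |y| show that both functions are
  1-Lipschitz, and such maps preserve uniform convergence.\<close>

lemma uniform_limit_cos_sin:
  fixes f :: "nat \<Rightarrow> real \<Rightarrow> real"
  assumes "uniform_limit A f g sequentially"
  shows "uniform_limit A (\<lambda>n t. cos (f n t)) (\<lambda>t. cos (g t)) sequentially"
    and "uniform_limit A (\<lambda>n t. sin (f n t)) (\<lambda>t. sin (g t)) sequentially"
proof -
  have lip: "\<bar>sin x * sin y * 2\<bar> \<le> \<bar>2 * y\<bar>" "\<bar>sin y * cos x * 2\<bar> \<le> \<bar>2 * y\<bar>" for x y :: real
  proof -
    have "\<bar>sin x\<bar> * \<bar>sin y\<bar> \<le> 1 * \<bar>y\<bar>" by (intro mult_mono abs_sin_x_le_abs_x) auto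
    then show "\<bar>sin x * sin y * 2\<bar> \<le> \<bar>2 * y\<bar>" by (simp add: abs_mult)
    have "\<bar>sin y\<bar> * \<bar>cos x\<bar> \<le> \<bar>y\<bar> * 1" by (intro mult_mono abs_sin_x_le_abs_x) auto
    then show "\<bar>sin y * cos x * 2\<bar> \<le> \<bar>2 * y\<bar>" by (simp add: abs_mult)
  qed
  have *: "dist (cos x) (cos y) \<le> dist x y" "dist (sin x) (sin y) \<le> dist x y" for x y :: real
    using lip(1)[of "(x + y) / 2" "(y - x) / 2"] lip(2)[of "(x - y) / 2" "(x + y) / 2"]
    by (simp_all add: dist_real_def cos_diff_cos sin_diff_sin mult_ac abs_minus_commute)
  have contr: "uniform_limit A (\<lambda>n t. h (f n t)) (\<lambda>t. h (g t)) sequentially"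
    if h: "\<And>x y. dist (h x) (h y) \<le> dist x y" for h :: "real \<Rightarrow> real"
    unfolding uniform_limit_iff
  proof (intro allI impI)
    fix e :: real assume "e > 0"
    with assms have "\<forall>\<^sub>F n in sequentially. \<forall>x\<in>A. dist (f n x) (g x) < e"
      unfolding uniform_limit_iff by blast
    then show "\<forall>\<^sub>F n in sequentially. \<forall>x\<in>A. dist (h (f n x)) (h (g x)) < e"
      by (rule eventually_mono) (use h in \<open>blast intro: le_less_trans\<close>)
  qed
  show "uniform_limit A (\<lambda>n t. cos (f n t)) (\<lambda>t. cos (g t)) sequentially"
    "uniform_limit A (\<lambda>n t. sin (f n t)) (\<lambda>t. sin (g t)) sequentially"
    by (intro contr *)+
qed

text \<open>Function and evaluation point move together, because curvature, heading and displacement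
  are read off at final times that vary along the sequence.\<close>

lemma uniform_limit_diagonal:
  fixes f :: "nat \<Rightarrow> real \<Rightarrow> real"
  assumes lim: "uniform_limit A f g sequentially" and g: "continuous_on A g"
    and t: "t \<longlonglongrightarrow> t0" "\<And>n. t n \<in> A" "t0 \<in> A"
  shows "(\<lambda>n. f n (t n)) \<longlonglongrightarrow> g t0"
proof -
  have "(\<lambda>n. g (t n)) \<longlonglongrightarrow> g t0"
    using continuous_on_tendsto_compose[OF g t(1)] t by auto
  moreover have "(\<lambda>n. f n (t n) - g (t n)) \<longlonglongrightarrow> 0"
  proof (rule tendstoI)
    fix e :: real assume "e > 0"
    with lim have "\<forall>\<^sub>F n in sequentially. \<forall>t\<in>A. dist (f n t) (g t) < e"
      unfolding uniform_limit_iff by blast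
    then show "\<forall>\<^sub>F n in sequentially. dist (f n (t n) - g (t n)) 0 < e"
      by eventually_elim (use t in \<open>auto simp: dist_real_def\<close>)
  qed
  ultimately have "(\<lambda>n. (f n (t n) - g (t n)) + g (t n)) \<longlonglongrightarrow> 0 + g t0" by (intro tendsto_add)
  then show ?thesis by simp
qed

text \<open>Every requirement is an equation, or membership in a closed set, for a quantity that
  converges under uniform convergence of the curvatures and convergence of the final times.\<close>

lemma reaches_limit:
  assumes lim: "uniform_limit {0..B} K K0 sequentially"
    and cont: "\<And>n. continuous_on {0..B} (K n)" "continuous_on {0..B} K0"
    and T: "T \<longlonglongrightarrow> T0" "\<And>n. T n \<in> {0..B}" "T0 \<in> {0..B}"
    and reach: "\<And>n. reaches X0 X1 (T n) (K n)"
  shows "reaches X0 X1 T0 K0"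
proof -
  obtain x0 y0 c0 k0 where X0: "X0 = (x0, y0, c0, k0)" by (cases X0)
  obtain x1 y1 c1 k1 where X1: "X1 = (x1, y1, c1, k1)" by (cases X1)
  let ?h = "\<lambda>n. heading (rep_circle c0) (K n)" and ?hlim = "heading (rep_circle c0) K0"
  have B: "0 \<le> B" using T(3) by simp
  have eqs: "K n 0 = k0" "K n (T n) = k1"
    "\<exists>j::int. ?h n (T n) = rep_circle c1 + 2 * pi * of_int j"
    "integral {0..T n} (\<lambda>t. cos (?h n t)) = x1 - x0"
    "integral {0..T n} (\<lambda>t. sin (?h n t)) = y1 - y0" for n
    using reach[of n] by (auto simp: reaches_def X0 X1)
  have h: "uniform_limit {0..B} ?h ?hlim sequentially"
    unfolding heading_def
    by (intro uniform_limit_intros uniform_limit_indefinite_integral lim cont B)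
  have h_cont: "continuous_on {0..B} (?h n)" "continuous_on {0..B} ?hlim" for n
    by (intro heading_continuous cont)+
  have "(\<lambda>n. K n 0) \<longlonglongrightarrow> K0 0" by (rule tendsto_uniform_limitI[OF lim]) (use B in auto)
  then have "K0 0 = k0" by (simp add: eqs LIMSEQ_const_iff)
  moreover have "(\<lambda>n. K n (T n)) \<longlonglongrightarrow> K0 T0" by (rule uniform_limit_diagonal[OF lim cont(2) T])
  then have "K0 T0 = k1" by (simp add: eqs LIMSEQ_const_iff)
  moreover have "\<exists>j::int. ?hlim T0 = rep_circle c1 + 2 * pi * of_int j"
  proof -
    have "(\<lambda>n. ?h n (T n)) \<longlonglongrightarrow> ?hlim T0" by (rule uniform_limit_diagonal[OF h h_cont(2) T])
    \<comment> \<open>The integer may vary with \<open>n\<close>. After rescaling, the differences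
      from the target angle lie in the integers, which form a closed set.\<close>
    then have "(\<lambda>n. (?h n (T n) - rep_circle c1) / (2 * pi)) \<longlonglongrightarrow> (?hlim T0 - rep_circle c1) / (2 * pi)"
      by (intro tendsto_intros) auto
    moreover have ints: "(?h n (T n) - rep_circle c1) / (2 * pi) \<in> \<int>" for n
      using eqs(3)[of n] by (auto simp: field_simps)
    ultimately have "(?hlim T0 - rep_circle c1) / (2 * pi) \<in> \<int>"
      by (intro closed_sequentially[OF closed_Ints ints])
    then obtain j :: int where "(?hlim T0 - rep_circle c1) / (2 * pi) = of_int j" by (auto elim: Ints_cases)
    then show ?thesis by (intro exI[of _ j]) (simp add: field_simps)
  qed
  moreover have "integral {0..T0} (\<lambda>t. cos (?hlim t)) = x1 - x0"
  proof -
    have "uniform_limit {0..B} (\<lambda>n t. integral {0..t} (\<lambda>t. cos (?h n t))) (\<lambda>t. integral {0..t} (\<lambda>t. cos (?hlim t))) sequentially"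
      by (intro uniform_limit_indefinite_integral uniform_limit_cos_sin h continuous_on_cos h_cont B)
    then have "(\<lambda>n. integral {0..T n} (\<lambda>t. cos (?h n t))) \<longlonglongrightarrow> integral {0..T0} (\<lambda>t. cos (?hlim t))"
      by (rule uniform_limit_diagonal)
         (intro indefinite_integral_continuous_1 integrable_continuous_real continuous_on_cos h_cont T)+
    then show ?thesis by (simp add: eqs LIMSEQ_const_iff)
  qed
  moreover have "integral {0..T0} (\<lambda>t. sin (?hlim t)) = y1 - y0"
  proof -
    have "uniform_limit {0..B} (\<lambda>n t. integral {0..t} (\<lambda>t. sin (?h n t))) (\<lambda>t. integral {0..t} (\<lambda>t. sin (?hlim t))) sequentially"
      by (intro uniform_limit_indefinite_integral uniform_limit_cos_sin h continuous_on_sin h_cont B)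
    then have "(\<lambda>n. integral {0..T n} (\<lambda>t. sin (?h n t))) \<longlonglongrightarrow> integral {0..T0} (\<lambda>t. sin (?hlim t))"
      by (rule uniform_limit_diagonal)
         (intro indefinite_integral_continuous_1 integrable_continuous_real continuous_on_sin h_cont T)+
    then show ?thesis by (simp add: eqs LIMSEQ_const_iff)
  qed
  ultimately show ?thesis by (simp add: reaches_def X0 X1)
qed

text \<open>With bounded curvature a short arc keeps at least half of its length as displacement in the
  initial direction, while that displacement is prescribed; so the times cannot shrink to \<open>0\<close>.\<close>

lemma reaches_time_limit_pos:
  assumes T: "T \<longlonglongrightarrow> T0" "\<And>n. 0 < T n"
    and K: "\<And>n. continuous_on {0..T n} (K n)" "\<And>n t. t \<in> {0..T n} \<Longrightarrow> \<bar>K n t\<bar> \<le> M"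
    and reach: "\<And>n. reaches X0 X1 (T n) (K n)"
  shows "0 < T0"
proof (rule ccontr)
  assume "\<not> 0 < T0"
  moreover have "0 \<le> T0" using LIMSEQ_le_const[OF T(1), of 0] T(2) less_imp_le by blast
  ultimately have T_0: "T \<longlonglongrightarrow> 0" using T(1) by simp
  obtain x0 y0 c0 k0 where X0: "X0 = (x0, y0, c0, k0)" by (cases X0)
  obtain x1 y1 c1 k1 where X1: "X1 = (x1, y1, c1, k1)" by (cases X1)
  define \<theta>0 where "\<theta>0 = rep_circle c0"
  \<comment> \<open>\<open>d\<close> is the prescribed displacement along the initial direction, the
    same for all \<open>n\<close>. Vanishing times force d \<le> 0, while a single short arc forces
    d > 0.\<close>
  define d where "d = cos \<theta>0 * (x1 - x0) + sin \<theta>0 * (y1 - y0)"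
  have M0: "0 \<le> M" using K(2)[of 0 0] T(2)[of 0] by force
  have d_eq: "d = integral {0..T n} (\<lambda>t. cos (heading \<theta>0 (K n) t - \<theta>0))"
    and h_cont: "continuous_on {0..T n} (heading \<theta>0 (K n))" for n
  proof -
    show h: "continuous_on {0..T n} (heading \<theta>0 (K n))" by (intro heading_continuous K)
    have "d = cos \<theta>0 * integral {0..T n} (\<lambda>t. cos (heading \<theta>0 (K n) t))
       + sin \<theta>0 * integral {0..T n} (\<lambda>t. sin (heading \<theta>0 (K n) t))"
      using reach[of n] by (simp add: d_def reaches_def X0 X1 \<theta>0_def)
    also have "\<dots> = integral {0..T n} (\<lambda>t. cos \<theta>0 * cos (heading \<theta>0 (K n) t) + sin \<theta>0 * sin (heading \<theta>0 (K n) t))"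
      using h by (subst integral_add) (auto intro!: integrable_continuous_real continuous_intros)
    finally show "d = integral {0..T n} (\<lambda>t. cos (heading \<theta>0 (K n) t - \<theta>0))"
      by (simp add: cos_diff mult.commute)
  qed
  have "d \<le> T n" for n
  proof -
    have "d \<le> integral {0..T n} (\<lambda>_. 1::real)"
      unfolding d_eq[of n] using h_cont[of n]
      by (intro integral_le integrable_continuous_real continuous_intros) auto
    then show ?thesis using T(2)[of n] by simp
  qed
  then have "d \<le> 0" using LIMSEQ_le_const[OF T_0] by blast
  \<comment> \<open>In time below 1/(M + 1) the heading turns by less than 1, hence by less than
    pi/3 because pi > 3, and the cosine stays above 1/2.\<close>
  have "0 < 1 / (M + 1)" using M0 by simp
  then have "\<forall>\<^sub>F n in sequentially. T n < 1 / (M + 1)" by (rule order_tendstoD(2)[OF T_0])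
  then obtain n where n: "T n < 1 / (M + 1)" using eventually_happens'[OF sequentially_bot] by blast
  have "cos (heading \<theta>0 (K n) t - \<theta>0) \<ge> 1 / 2" if t: "t \<in> {0..T n}" for t
  proof -
    have "norm (integral {0..t} (K n)) \<le> M * (t - 0)"
      using t K(2)[of _ n] by (intro integral_bound continuous_on_subset[OF K(1)[of n]]) auto
    also have "\<dots> \<le> (M + 1) * T n" using t M0 by (intro mult_mono) auto
    also have "\<dots> < 1" using n M0 by (simp add: field_simps)
    finally have small: "\<bar>heading \<theta>0 (K n) t - \<theta>0\<bar> \<le> pi / 3"
      using pi_gt3 by (simp add: heading_def)
    have "cos (pi / 3) \<le> cos \<bar>heading \<theta>0 (K n) t - \<theta>0\<bar>"
      using small pi_gt3 by (intro cos_monotone_0_pi_le) auto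
    then show ?thesis by (simp add: cos_60)
  qed
  then have "integral {0..T n} (\<lambda>_. 1 / 2 :: real) \<le> d"
    unfolding d_eq[of n] using h_cont[of n]
    by (intro integral_le integrable_continuous_real continuous_intros) auto
  then have "0 < d" using T(2)[of n] by simp
  with \<open>d \<le> 0\<close> show False by simp
qed

section \<open>Existence of a minimizer\<close>

text \<open>Almost everywhere differentiability is available for functions monotone and continuous
  on the whole line, while limits are known on [0, B] only. Freezing the limit outside keeps both
  properties.\<close>

lemma uniform_limit_clamp_mono:
  fixes f :: "nat \<Rightarrow> real \<Rightarrow> real"
  assumes lim: "\<And>t. t \<in> {0..B} \<Longrightarrow> (\<lambda>n. f n t) \<longlonglongrightarrow> g t" and mono: "\<And>n. mono (f n)"
    and g: "continuous_on {0..B} g" and B: "0 \<le> B"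
  shows "mono (\<lambda>t. g (min (max t 0) B))" "continuous_on UNIV (\<lambda>t. g (min (max t 0) B))"
proof -
  show "continuous_on UNIV (\<lambda>t. g (min (max t 0) B))"
    by (rule continuous_on_compose2[OF g]) (use B in \<open>auto intro!: continuous_intros\<close>)
  show "mono (\<lambda>t. g (min (max t 0) B))"
  proof (rule monoI)
    fix s t :: real assume "s \<le> t"
    then have "min (max s 0) B \<le> min (max t 0) B" by auto
    then show "g (min (max s 0) B) \<le> g (min (max t 0) B)"
      using B mono by (intro LIMSEQ_le[OF lim lim]) (auto simp: mono_def)
  qed
qed

lemma primitive_pos_neg:
  assumes "integrable lborel v"
  shows "primitive v t = primitive (\<lambda>s. max 0 (v s)) t - primitive (\<lambda>s. max 0 (- v s)) t"
proof -
  have "set_integrable lborel {..t} (\<lambda>s. max 0 (v s))" "set_integrable lborel {..t} (\<lambda>s. max 0 (- v s))"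
    unfolding set_integrable_def using assms by (intro integrable_mult_indicator integrable_max; simp)+
  then have "(LINT s:{..t}|lborel. max 0 (v s) - max 0 (- v s)) =
      (LINT s:{..t}|lborel. max 0 (v s)) - (LINT s:{..t}|lborel. max 0 (- v s))"
    by (rule set_integral_diff(2))
  moreover have "(\<lambda>s. max 0 (v s) - max 0 (- v s)) = v" by auto
  ultimately show ?thesis by (simp only: primitive_def)
qed

text \<open>The controls are split as \<open>v = v\<^sup>+ - v\<^sup>-\<close> because the limits of the two primitives are then
  monotone, hence differentiable almost everywhere.\<close>

lemma minimizing_sequence_limit:
  fixes \<phi> \<psi> :: "real \<Rightarrow> real" and v :: "nat \<Rightarrow> real \<Rightarrow> real" and T :: "nat \<Rightarrow> real"
  assumes \<phi>: "\<And>r. 0 \<le> \<phi> r" "continuous_on UNIV \<phi>"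
    and \<psi>: "\<And>r. 0 \<le> \<psi> r" "\<And>r. \<psi> (- r) = \<psi> r" "convex_on UNIV \<psi>" "\<And>r. \<psi> differentiable at r" "\<psi> 0 = 0"
    and growth: "\<And>r. \<bar>r\<bar> \<ge> R \<Longrightarrow> \<psi> r \<ge> C * \<bar>r\<bar> powr p" and pCR: "1 < p" "0 < C" "0 < R"
    and T: "\<And>n. 0 < T n"
    and v: "\<And>n. integrable lborel (v n)" "\<And>n t. t \<notin> {0..T n} \<Longrightarrow> v n t = 0"
    and reach: "\<And>n. reaches X0 X1 (T n) (\<lambda>t. curvature X0 + primitive (v n) t)"
    and J: "\<And>n. (\<integral>\<^sup>+t. ennreal (indicator {0..T n} t *
        (1 + \<phi> (curvature X0 + primitive (v n) t)) + \<psi> (v n t)) \<partial>lborel) \<le> ennreal (\<mu> n)"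
    and \<mu>: "\<mu> \<longlonglongrightarrow> \<mu>0" "\<And>n. 0 \<le> \<mu> n" "\<And>n. \<mu> n \<le> M"
  obtains T0 u X where "admissible p X0 X1 T0 u X" "cost \<phi> \<psi> T0 u X \<le> ennreal \<mu>0"
proof -
  have \<psi>_cont: "continuous_on UNIV \<psi>"
    using \<psi>(4) by (meson continuous_at_imp_continuous_on differentiable_imp_continuous_within)
  have [measurable]: "\<psi> \<in> borel_measurable borel" "\<phi> \<in> borel_measurable borel"
    using \<psi>_cont \<phi>(2) by (auto intro: borel_measurable_continuous_onI)
  have v_meas [measurable]: "v n \<in> borel_measurable borel" for n using v(1)[of n] by (auto dest: borel_measurable_integrable)
  have prim_meas [measurable]: "primitive (v n) \<in> borel_measurable borel" for n
    using primitive_continuous[OF v(1)] by (rule borel_measurable_continuous_onI)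
  have M0: "0 \<le> M" using \<mu>(2,3)[of 0] by simp
  let ?K = "\<lambda>n t. curvature X0 + primitive (v n) t"

  \<comment> \<open>A priori bounds on times and controls\<close>
  have J_split: "(\<integral>\<^sup>+t. ennreal (indicator {0..T n} t * (1 + \<phi> (?K n t))) \<partial>lborel) + (\<integral>\<^sup>+t. ennreal (\<psi> (v n t)) \<partial>lborel)
      \<le> ennreal (\<mu> n)" for n
  proof -
    have "(\<integral>\<^sup>+t. ennreal (indicator {0..T n} t * (1 + \<phi> (?K n t))) \<partial>lborel) + (\<integral>\<^sup>+t. ennreal (\<psi> (v n t)) \<partial>lborel)
      = (\<integral>\<^sup>+t. ennreal (indicator {0..T n} t * (1 + \<phi> (?K n t))) + ennreal (\<psi> (v n t)) \<partial>lborel)"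
      by (rule nn_integral_add[symmetric]) measurable
    also have "\<dots> = (\<integral>\<^sup>+t. ennreal (indicator {0..T n} t * (1 + \<phi> (?K n t)) + \<psi> (v n t)) \<partial>lborel)"
      using \<phi>(1) \<psi>(1) by (intro nn_integral_cong ennreal_plus[symmetric]) (auto simp: add_nonneg_nonneg)
    finally show ?thesis using J[of n] by simp
  qed
  have TM: "T n \<le> M" for n
  proof -
    have "ennreal (T n) = (\<integral>\<^sup>+t. indicator {0..T n} t \<partial>lborel)"
      using T[of n] by simp
    also have "\<dots> \<le> (\<integral>\<^sup>+t. ennreal (indicator {0..T n} t * (1 + \<phi> (?K n t))) \<partial>lborel)"
      using \<phi>(1) by (intro nn_integral_mono) (auto simp: indicator_def ennreal_1[symmetric] simp del: ennreal_1 intro!: ennreal_leI)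
    also have "\<dots> \<le> ennreal (\<mu> n)" using J_split[of n] by (rule order_trans[rotated]) (simp add: add_increasing2)
    finally show ?thesis using \<mu>(2,3)[of n] by (simp add: ennreal_le_iff)
  qed
  have \<psi>_bound: "(\<integral>\<^sup>+t. ennreal (\<psi> (v n t)) \<partial>lborel) \<le> ennreal (\<mu> n)" for n
    using J_split[of n] by (rule order_trans[rotated]) (simp add: add_increasing)
  \<comment> \<open>One hypothesis serves \<open>v n\<close>, its positive part and its negative
    part: \<psi> is even, nonnegative and zero at 0, so \<psi>(w) \<le> \<psi>(v) for each of
    them.\<close>
  have \<psi>_M: "(\<integral>\<^sup>+t. ennreal (\<psi> (w t)) \<partial>lborel) \<le> ennreal M"
    if "\<And>t. w t \<in> {0, v n t, - v n t}" for n w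
  proof -
    have "(\<integral>\<^sup>+t. ennreal (\<psi> (w t)) \<partial>lborel) \<le> (\<integral>\<^sup>+t. ennreal (\<psi> (v n t)) \<partial>lborel)"
    proof (intro nn_integral_mono ennreal_leI)
      show "\<psi> (w t) \<le> \<psi> (v n t)" for t using that[of t] \<psi>(1,2,5) by auto
    qed
    also have "\<dots> \<le> ennreal (\<mu> n)" by (rule \<psi>_bound)
    also have "\<dots> \<le> ennreal M" using \<mu>(3) by (rule ennreal_leI)
    finally show ?thesis .
  qed

  \<comment> \<open>Equicontinuity of the positive and negative primitives\<close>
  define vp where "vp n t = max 0 (v n t)" for n t
  define vn where "vn n t = max 0 (- v n t)" for n t
  have vpn: "integrable lborel (vp n)" "integrable lborel (vn n)" "0 \<le> vp n t" "0 \<le> vn n t"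
    "vp n t \<in> {0, v n t, - v n t}" "vn n t \<in> {0, v n t, - v n t}"
    "t \<notin> {0..T n} \<Longrightarrow> vp n t = 0" "t \<notin> {0..T n} \<Longrightarrow> vn n t = 0" for n t
  proof -
    show "integrable lborel (vp n)" "integrable lborel (vn n)"
      unfolding vp_def[abs_def] vn_def[abs_def] using v(1)[of n] by (intro integrable_max; simp)+
  qed (use v(2)[of t n] in \<open>auto simp: vp_def vn_def max_def\<close>)
  have K_eq: "primitive (v n) t = primitive (vp n) t - primitive (vn n) t" for n t
    unfolding vp_def[abs_def] vn_def[abs_def] by (rule primitive_pos_neg[OF v(1)])
  have UI: "\<exists>L>0. \<forall>n w A. integrable lborel w \<longrightarrow> (\<forall>t. w t \<in> {0, v n t, - v n t}) \<longrightarrow> A \<in> sets borel \<longrightarrow>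
      emeasure lborel A < \<infinity> \<longrightarrow> (LINT r:A|lborel. \<bar>w r\<bar>) \<le> L * measure lborel A + e"
    if "0 < e" for e
  proof -
    obtain L where "0 < L"
      "\<And>(w :: real \<Rightarrow> real) A. integrable lborel w \<Longrightarrow> (\<integral>\<^sup>+t. ennreal (\<psi> (w t)) \<partial>lborel) \<le> ennreal M \<Longrightarrow>
       A \<in> sets borel \<Longrightarrow> emeasure lborel A < \<infinity> \<Longrightarrow> (LINT r:A|lborel. \<bar>w r\<bar>) \<le> L * measure lborel A + e"
      by (rule uniform_integrability[of R C p \<psi> M e]) (use growth \<psi>(1) pCR M0 \<open>0 < e\<close> in auto)
    then show ?thesis using \<psi>_M by (intro exI[of _ L]) blast
  qed
  \<comment> \<open>The times are at most \<open>M\<close>. The extra unit leaves room for t + h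
    when difference quotients with step h \<le> 1 are taken at times up to the limit time.\<close>
  define B where "B = M + 1"
  have B: "0 < B" "T n \<le> B" "0 \<le> B" for n using M0 TM[of n] by (auto simp: B_def)

  \<comment> \<open>For each tolerance \<open>e\<close> a slope \<open>L\<close> works for all
    \<open>n\<close>: this is equicontinuity in a form that needs no common Lipschitz
    constant.\<close>
  have equi: "\<exists>L>0. \<forall>n s t. s \<le> t \<longrightarrow>
      \<bar>primitive (vp n) t - primitive (vp n) s\<bar> \<le> L * (t - s) + e \<and> \<bar>primitive (vn n) t - primitive (vn n) s\<bar> \<le> L * (t - s) + e"
    if "0 < e" for e
  proof -
    obtain L where L: "L > 0" "\<And>n w A. integrable lborel w \<Longrightarrow> (\<And>t. w t \<in> {0, v n t, - v n t}) \<Longrightarrow> A \<in> sets borel \<Longrightarrow>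
      emeasure lborel A < \<infinity> \<Longrightarrow> (LINT r:A|lborel. \<bar>w r\<bar>) \<le> L * measure lborel A + e"
      using UI[OF \<open>0 < e\<close>] by blast
    show ?thesis
    proof (intro exI[of _ L] conjI allI impI L(1))
      fix n :: nat and s t :: real assume st: "s \<le> t"
      have "(LINT r:{s<..t}|lborel. \<bar>w r\<bar>) \<le> L * (t - s) + e"
        if "integrable lborel w" "\<And>t. w t \<in> {0, v n t, - v n t}" for w
        using L(2)[OF that, of "{s<..t}"] st by simp
      from this[OF vpn(1,5)] this[OF vpn(2,6)]
      show "\<bar>primitive (vp n) t - primitive (vp n) s\<bar> \<le> L * (t - s) + e"
        "\<bar>primitive (vn n) t - primitive (vn n) s\<bar> \<le> L * (t - s) + e"
        using primitive_diff_le[OF vpn(1) st] primitive_diff_le[OF vpn(2) st] order_trans by blast+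
    qed
  qed
  have prim0: "primitive (vp n) t = 0" "primitive (vn n) t = 0" if "t \<le> 0" for n t
    using that vpn(7,8) by (auto intro!: primitive_eq_0)

  \<comment> \<open>Extraction of limits for the times and the primitives\<close>
  obtain T0 r where r: "strict_mono r" "(T \<circ> r) \<longlonglongrightarrow> T0" and T0: "T0 \<in> {0..M}"
  proof -
    have "\<forall>n. T n \<in> {0..M}" using T TM by (simp add: less_imp_le)
    then show thesis using that compact_Icc[of 0 M] unfolding compact_def by blast
  qed
  \<comment> \<open>Pairing both primitives lets one application of Arzela-Ascoli give a common
    subsequence for the two monotone limits.\<close>
  define F where "F n t = (primitive (vp (r n)) t, primitive (vn (r n)) t)" for n t
  obtain L1 where L1: "0 < L1" "\<And>n s t. s \<le> t \<Longrightarrow> \<bar>primitive (vp n) t - primitive (vp n) s\<bar> \<le> L1 * (t - s) + 1"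
     "\<And>n s t. s \<le> t \<Longrightarrow> \<bar>primitive (vn n) t - primitive (vn n) s\<bar> \<le> L1 * (t - s) + 1"
    using equi[of 1] by auto
  have prim_bound: "\<bar>primitive (vp n) t\<bar> \<le> L1 * B + 1" "\<bar>primitive (vn n) t\<bar> \<le> L1 * B + 1" if "t \<in> {0..B}" for n t
  proof -
    have "L1 * t \<le> L1 * B" using that L1 by simp
    then show "\<bar>primitive (vp n) t\<bar> \<le> L1 * B + 1" "\<bar>primitive (vn n) t\<bar> \<le> L1 * B + 1"
      using L1(2)[of 0 t n] L1(3)[of 0 t n] that prim0[of 0] by auto
  qed
  obtain G k where G: "continuous_on {0..B} G" and k: "strict_mono (k :: nat \<Rightarrow> nat)"
    and Glim: "\<And>e. 0 < e \<Longrightarrow> \<exists>N. \<forall>n t. n \<ge> N \<and> t \<in> {0..B} \<longrightarrow> norm (F (k n) t - G t) < e"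
  proof (rule Arzela_Ascoli[of "{0..B}" F "2 * (L1 * B + 1)"])
    show "norm (F n t) \<le> 2 * (L1 * B + 1)" if "t \<in> {0..B}" for n t
      using norm_Pair_le[of "primitive (vp (r n)) t" "primitive (vn (r n)) t"] prim_bound[OF that, of "r n"]
      unfolding F_def by simp
    show "\<exists>d. 0 < d \<and> (\<forall>n y. y \<in> {0..B} \<and> norm (x - y) < d \<longrightarrow> norm (F n x - F n y) < e)"
      if "x \<in> {0..B}" "0 < e" for x e
    proof -
      obtain L where L: "0 < L" "\<And>n s t. s \<le> t \<Longrightarrow> \<bar>primitive (vp n) t - primitive (vp n) s\<bar> \<le> L * (t - s) + e / 4"
         "\<And>n s t. s \<le> t \<Longrightarrow> \<bar>primitive (vn n) t - primitive (vn n) s\<bar> \<le> L * (t - s) + e / 4"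
        using equi[of "e / 4"] \<open>0 < e\<close> by auto
      have *: "\<bar>primitive (vp n) t - primitive (vp n) s\<bar> \<le> L * \<bar>t - s\<bar> + e / 4 \<and>
            \<bar>primitive (vn n) t - primitive (vn n) s\<bar> \<le> L * \<bar>t - s\<bar> + e / 4" for n s t
        using L(2)[of s t n] L(2)[of t s n] L(3)[of s t n] L(3)[of t s n]
        by (cases "s \<le> t") (auto simp: abs_minus_commute)
      show ?thesis
      \<comment> \<open>Each of the two components then changes by less than e/4 + e/4, so the pair
        changes by less than \<open>e\<close>.\<close>
      proof (intro exI[of _ "e / (4 * L)"] conjI allI impI)
        show "0 < e / (4 * L)" using L \<open>0 < e\<close> by simp
        fix n y assume "y \<in> {0..B} \<and> norm (x - y) < e / (4 * L)"
        then have "L * \<bar>x - y\<bar> < e / 4" using L by (simp add: field_simps)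
        moreover have "norm (F n x - F n y) \<le> \<bar>primitive (vp (r n)) x - primitive (vp (r n)) y\<bar> +
            \<bar>primitive (vn (r n)) x - primitive (vn (r n)) y\<bar>"
          unfolding F_def using norm_Pair_le[of "primitive (vp (r n)) x - primitive (vp (r n)) y" "primitive (vn (r n)) x - primitive (vn (r n)) y"] by simp
        ultimately show "norm (F n x - F n y) < e" using *[of "r n" x y] by linarith
      qed
    qed
  qed auto
  define s where "s = r \<circ> k"
  have s: "strict_mono s" unfolding s_def using r(1) k by (rule strict_mono_o)
  have Ts: "(\<lambda>n. T (s n)) \<longlonglongrightarrow> T0"
    using LIMSEQ_subseq_LIMSEQ[OF r(2) k] by (simp add: s_def o_def)
  have \<mu>s: "(\<lambda>n. \<mu> (s n)) \<longlonglongrightarrow> \<mu>0" using LIMSEQ_subseq_LIMSEQ[OF \<mu>(1) s] by (simp add: o_def)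
  have lims: "uniform_limit {0..B} (\<lambda>n. primitive (vp (s n))) (\<lambda>t. fst (G t)) sequentially"
    "uniform_limit {0..B} (\<lambda>n. primitive (vn (s n))) (\<lambda>t. snd (G t)) sequentially"
  proof -
    have *: "\<bar>primitive (vp (s n)) t - fst (G t)\<bar> \<le> norm (F (k n) t - G t)"
      "\<bar>primitive (vn (s n)) t - snd (G t)\<bar> \<le> norm (F (k n) t - G t)" for n t
    proof -
      have "\<bar>fst z\<bar> \<le> norm z" "\<bar>snd z\<bar> \<le> norm z" for z :: "real \<times> real"
        using norm_fst_le[of "fst z" "snd z"] norm_snd_le[of "snd z" "fst z"] by simp_all
      from this[of "F (k n) t - G t"] show "\<bar>primitive (vp (s n)) t - fst (G t)\<bar> \<le> norm (F (k n) t - G t)"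
        "\<bar>primitive (vn (s n)) t - snd (G t)\<bar> \<le> norm (F (k n) t - G t)"
        by (simp_all add: F_def s_def fst_diff snd_diff)
    qed
    have conv: "uniform_limit {0..B} f g sequentially"
      if fg: "\<And>n t. \<bar>f n t - g t\<bar> \<le> norm (F (k n) t - G t)" for f g
      unfolding uniform_limit_sequentially_iff dist_real_def
    proof (intro allI impI)
      fix e :: real assume "0 < e"
      then obtain N where "\<forall>n t. n \<ge> N \<and> t \<in> {0..B} \<longrightarrow> norm (F (k n) t - G t) < e" using Glim by blast
      then show "\<exists>N. \<forall>n\<ge>N. \<forall>t\<in>{0..B}. \<bar>f n t - g t\<bar> < e"
        using fg le_less_trans by (intro exI[of _ N]) blast
    qed
    show "uniform_limit {0..B} (\<lambda>n. primitive (vp (s n))) (\<lambda>t. fst (G t)) sequentially"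
      "uniform_limit {0..B} (\<lambda>n. primitive (vn (s n))) (\<lambda>t. snd (G t)) sequentially"
      using * by (auto intro: conv)
  qed
  let ?cl = "\<lambda>t. min (max t 0) B"
  define U where "U t = fst (G (?cl t))" for t
  define D where "D t = snd (G (?cl t))" for t
  define K where "K t = curvature X0 + U t - D t" for t
  have UD: "mono U" "continuous_on UNIV U" "mono D" "continuous_on UNIV D"
    unfolding U_def[abs_def] D_def[abs_def]
    by (rule uniform_limit_clamp_mono[OF tendsto_uniform_limitI[OF lims(1)]]
          uniform_limit_clamp_mono[OF tendsto_uniform_limitI[OF lims(2)]];
        (use B G vpn in \<open>auto intro!: primitive_mono continuous_intros\<close>))+
  have K_cont: "continuous_on A K" for A
    unfolding K_def[abs_def] using UD by (intro continuous_intros) (auto intro: continuous_on_subset)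
  have [measurable]: "K \<in> borel_measurable borel" using K_cont by (rule borel_measurable_continuous_onI)
  have K_lim: "uniform_limit {0..B} (\<lambda>n. ?K (s n)) K sequentially"
  proof -
    have "uniform_limit {0..B} (\<lambda>n t. curvature X0 + (primitive (vp (s n)) t - primitive (vn (s n)) t))
        (\<lambda>t. curvature X0 + (fst (G t) - snd (G t))) sequentially"
      by (intro uniform_limit_intros lims)
    then show ?thesis
      by (rule uniform_limit_cong'[THEN iffD1, rotated 2]) (auto simp: K_eq K_def U_def D_def)
  qed
  have K_ptw: "(\<lambda>n. ?K (s n) t) \<longlonglongrightarrow> K t" if "t \<in> {0..B}" for t
    using that by (rule tendsto_uniform_limitI[OF K_lim])
  have Kn_cont: "continuous_on A (?K n)" for A n
    by (intro continuous_intros primitive_continuous v)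
  have T0B: "T0 \<in> {0..B}" using T0 by (auto simp: B_def)
  have reachK: "reaches X0 X1 T0 K"
    by (rule reaches_limit[OF K_lim Kn_cont K_cont Ts _ T0B reach]) (use B T in \<open>auto intro: less_imp_le\<close>)
  have T0_pos: "0 < T0"
  proof (rule reaches_time_limit_pos[OF Ts T Kn_cont _ reach])
    fix n t assume "t \<in> {0..T (s n)}"
    then have "t \<in> {0..B}" using B(2)[of "s n"] by auto
    then show "\<bar>?K (s n) t\<bar> \<le> \<bar>curvature X0\<bar> + 2 * (L1 * B + 1)"
      using prim_bound[of t "s n"] unfolding K_eq by auto
  qed

  \<comment> \<open>Absolute continuity of the limit curvature\<close>
  have AC: "absolutely_cont 0 T0 K"
    unfolding absolutely_cont_def
  proof (intro allI impI)
    fix \<epsilon> :: real assume \<epsilon>: "0 < \<epsilon>"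
    \<comment> \<open>The estimate holds for every curvature of the sequence with one
      \<open>L\<close>. For a fixed finite family of intervals it passes to the pointwise limit as a
      weak inequality, and the choice \<epsilon>/2 keeps the final inequality strict.\<close>
    obtain L where L: "L > 0" "\<And>n w A. integrable lborel w \<Longrightarrow> (\<And>t. w t \<in> {0, v n t, - v n t}) \<Longrightarrow> A \<in> sets borel \<Longrightarrow>
      emeasure lborel A < \<infinity> \<Longrightarrow> (LINT r:A|lborel. \<bar>w r\<bar>) \<le> L * measure lborel A + \<epsilon> / 2"
      using UI[OF half_gt_zero[OF \<epsilon>]] by blast
    show "\<exists>\<delta>>0. \<forall>(n::nat) a b. (\<forall>k<n. 0 \<le> a k \<and> a k \<le> b k \<and> b k \<le> T0) \<longrightarrow>
        disjoint_family_on (\<lambda>k. {a k<..<b k}) {..<n} \<longrightarrow> (\<Sum>k<n. b k - a k) < \<delta> \<longrightarrow>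
        (\<Sum>k<n. \<bar>K (b k) - K (a k)\<bar>) < \<epsilon>"
    proof (intro exI[of _ "\<epsilon> / (2 * L)"] conjI allI impI)
      show "0 < \<epsilon> / (2 * L)" using \<epsilon> L by simp
      fix n :: nat and a b :: "nat \<Rightarrow> real"
      assume ab: "\<forall>k<n. 0 \<le> a k \<and> a k \<le> b k \<and> b k \<le> T0"
        and disj: "disjoint_family_on (\<lambda>k. {a k<..<b k}) {..<n}" and small: "(\<Sum>k<n. b k - a k) < \<epsilon> / (2 * L)"
      have abB: "a k \<in> {0..B}" "b k \<in> {0..B}" if "k < n" for k using ab T0B that by force+
      have "(\<lambda>j. \<Sum>k<n. \<bar>?K (s j) (b k) - ?K (s j) (a k)\<bar>) \<longlonglongrightarrow> (\<Sum>k<n. \<bar>K (b k) - K (a k)\<bar>)"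
        using abB by (intro tendsto_intros K_ptw) auto
      moreover have "(\<Sum>k<n. \<bar>?K (s j) (b k) - ?K (s j) (a k)\<bar>) \<le> L * (\<Sum>k<n. b k - a k) + \<epsilon> / 2" for j
      proof -
        have "(\<Sum>k<n. \<bar>primitive (v (s j)) (b k) - primitive (v (s j)) (a k)\<bar>) \<le> L * (\<Sum>k<n. b k - a k) + \<epsilon> / 2"
        proof (rule primitive_sum_le[OF v(1) _ disj])
          show "\<forall>k<n. a k \<le> b k" using ab by simp
          show "(LINT r:A|lborel. \<bar>v (s j) r\<bar>) \<le> L * measure lborel A + \<epsilon> / 2"
            if "A \<in> sets borel" "emeasure lborel A < \<infinity>" for A
            by (rule L(2)[where n = "s j", OF v(1) _ that]) simp
        qed
        then show ?thesis by simp
      qed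
      ultimately have "(\<Sum>k<n. \<bar>K (b k) - K (a k)\<bar>) \<le> L * (\<Sum>k<n. b k - a k) + \<epsilon> / 2"
        by (intro LIMSEQ_le_const2) auto
      moreover have "L * (\<Sum>k<n. b k - a k) < \<epsilon> / 2" using small L by (simp add: field_simps)
      ultimately show "(\<Sum>k<n. \<bar>K (b k) - K (a k)\<bar>) < \<epsilon>" by linarith
    qed
  qed

  \<comment> \<open>The limit control as a limit of difference quotients\<close>
  define h where "h m = 1 / (real m + 1)" for m :: nat
  have h: "0 < h m" "h m \<le> 1" for m by (auto simp: h_def)
  have h_lim: "h \<longlonglongrightarrow> 0" unfolding h_def[abs_def] by real_asymp
  define q where "q m t = (K (t + h m) - K t) / h m" for m t
  \<comment> \<open>A limit along the fixed sequence \<open>h\<close> makes \<open>u\<close> Borel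
    measurable. Where the quotients diverge the value is arbitrary, which concerns only a null
    set.\<close>
  define u where "u t = lim (\<lambda>m. q m t)" for t
  have q_meas [measurable]: "q m \<in> borel_measurable borel" for m unfolding q_def[abs_def] by measurable
  have u_meas [measurable]: "u \<in> borel_measurable borel" unfolding u_def[abs_def] by measurable
  have u_AE: "AE t in lborel. (K has_real_derivative u t) (at t) \<and> (\<lambda>m. q m t) \<longlonglongrightarrow> u t"
    using mono_continuous_differentiable_AE[OF UD(1,2)] mono_continuous_differentiable_AE[OF UD(3,4)]
  proof eventually_elim
    case (elim t)
    then have "K differentiable at t" unfolding K_def[abs_def] by (intro derivative_intros)
    then obtain l where l: "(K has_real_derivative l) (at t)" using real_differentiable_def by blast
    have "filterlim h (at 0) sequentially"
      using h_lim h by (intro filterlim_atI) (auto simp: less_imp_neq[symmetric] intro!: always_eventually)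
    then have "(\<lambda>m. q m t) \<longlonglongrightarrow> l"
      using l unfolding DERIV_def q_def by (rule filterlim_compose[rotated])
    moreover from this have "u t = l" unfolding u_def by (rule limI)
    ultimately show ?case using l by simp
  qed

  \<comment> \<open>Lower semicontinuity of the cost\<close>
  have step: "(\<integral>\<^sup>+t. ennreal (indicator {0<..<T0} t * (1 + \<phi> (K t) + \<psi> (q m t))) \<partial>lborel) \<le> ennreal \<mu>0" for m
  proof -
    \<comment> \<open>The \<psi> term is not cut off at the final time: Jensen's inequality for
      sliding averages is an estimate on the whole line.\<close>
    define g where "g n t = ennreal (indicator {0..T (s n)} t * (1 + \<phi> (?K (s n) t)))
        + ennreal (\<psi> ((primitive (v (s n)) (t + h m) - primitive (v (s n)) t) / h m))" for n t
    have [measurable]: "g n \<in> borel_measurable borel" for n unfolding g_def[abs_def] by measurable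
    have g_int: "(\<integral>\<^sup>+t. g n t \<partial>lborel) \<le> ennreal (\<mu> (s n))" for n
    proof -
      have "(\<integral>\<^sup>+t. g n t \<partial>lborel) = (\<integral>\<^sup>+t. ennreal (indicator {0..T (s n)} t * (1 + \<phi> (?K (s n) t))) \<partial>lborel)
        + (\<integral>\<^sup>+t. ennreal (\<psi> ((primitive (v (s n)) (t + h m) - primitive (v (s n)) t) / h m)) \<partial>lborel)"
        unfolding g_def by (rule nn_integral_add) measurable
      also have "\<dots> \<le> (\<integral>\<^sup>+t. ennreal (indicator {0..T (s n)} t * (1 + \<phi> (?K (s n) t))) \<partial>lborel)
        + (\<integral>\<^sup>+t. ennreal (\<psi> (v (s n) t)) \<partial>lborel)"
        using Jensen_sliding[OF \<psi>(3,1,4) v(1) h(1)] by (intro add_left_mono)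
      also have "\<dots> \<le> ennreal (\<mu> (s n))" by (rule J_split)
      finally show ?thesis .
    qed
    have "(\<integral>\<^sup>+t. ennreal (indicator {0<..<T0} t * (1 + \<phi> (K t) + \<psi> (q m t))) \<partial>lborel)
        \<le> (\<integral>\<^sup>+t. liminf (\<lambda>n. g n t) \<partial>lborel)"
    proof (rule nn_integral_mono)
      fix t
      show "ennreal (indicator {0<..<T0} t * (1 + \<phi> (K t) + \<psi> (q m t))) \<le> liminf (\<lambda>n. g n t)"
      \<comment> \<open>For t < T0 the time \<open>t\<close> eventually lies before the final times
        of the sequence, so the running cost is counted there. At T0 itself this could fail, hence
        the open interval.\<close>
      proof (cases "t \<in> {0<..<T0}")
        case True
        then have tB: "t \<in> {0..B}" "t + h m \<in> {0..B}"
          using T0 h(1)[of m] h(2)[of m] by (auto simp: B_def)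
        have \<phi>t: "(\<lambda>n. \<phi> (?K (s n) t)) \<longlonglongrightarrow> \<phi> (K t)"
          using continuous_on_tendsto_compose[OF \<phi>(2) K_ptw[OF tB(1)]] by simp
        have "(\<lambda>n. (?K (s n) (t + h m) - ?K (s n) t) / h m) \<longlonglongrightarrow> q m t"
          unfolding q_def using h(1)[of m] by (intro tendsto_intros K_ptw tB) auto
        then have "(\<lambda>n. (primitive (v (s n)) (t + h m) - primitive (v (s n)) t) / h m) \<longlonglongrightarrow> q m t"
          by simp
        then have \<psi>t: "(\<lambda>n. \<psi> ((primitive (v (s n)) (t + h m) - primitive (v (s n)) t) / h m)) \<longlonglongrightarrow> \<psi> (q m t)"
          using continuous_on_tendsto_compose[OF \<psi>_cont] by simp
        have "\<forall>\<^sub>F n in sequentially. t < T (s n)" using order_tendstoD(1)[OF Ts] True by simp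
        then have ev: "\<forall>\<^sub>F n in sequentially. ennreal (1 + \<phi> (?K (s n) t) + \<psi> ((primitive (v (s n)) (t + h m) - primitive (v (s n)) t) / h m)) = g n t"
          by (rule eventually_mono)
             (use True \<phi>(1) \<psi>(1) in \<open>simp add: g_def ennreal_plus[symmetric] del: ennreal_plus\<close>)
        have "(\<lambda>n. ennreal (1 + \<phi> (?K (s n) t) + \<psi> ((primitive (v (s n)) (t + h m) - primitive (v (s n)) t) / h m)))
            \<longlonglongrightarrow> ennreal (1 + \<phi> (K t) + \<psi> (q m t))"
          by (intro tendsto_ennrealI tendsto_intros \<phi>t \<psi>t)
        then have "(\<lambda>n. g n t) \<longlonglongrightarrow> ennreal (1 + \<phi> (K t) + \<psi> (q m t))"
          using ev by (rule Lim_transform_eventually)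
        then have "liminf (\<lambda>n. g n t) = ennreal (1 + \<phi> (K t) + \<psi> (q m t))"
          by (intro lim_imp_Liminf) auto
        then show ?thesis using True by simp
      qed (simp del: greaterThanLessThan_iff)
    qed
    also have "\<dots> \<le> liminf (\<lambda>n. \<integral>\<^sup>+t. g n t \<partial>lborel)" by (rule nn_integral_liminf) measurable
    also have "\<dots> \<le> liminf (\<lambda>n. ennreal (\<mu> (s n)))" by (intro Liminf_mono always_eventually allI g_int)
    also have "\<dots> = ennreal \<mu>0" by (intro lim_imp_Liminf tendsto_ennrealI \<mu>s) auto
    finally show ?thesis .
  qed
  have total: "(\<integral>\<^sup>+t. ennreal (indicator {0<..<T0} t * (1 + \<phi> (K t) + \<psi> (u t))) \<partial>lborel) \<le> ennreal \<mu>0"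
  proof -
    have "(\<integral>\<^sup>+t. ennreal (indicator {0<..<T0} t * (1 + \<phi> (K t) + \<psi> (u t))) \<partial>lborel)
        \<le> (\<integral>\<^sup>+t. liminf (\<lambda>m. ennreal (indicator {0<..<T0} t * (1 + \<phi> (K t) + \<psi> (q m t)))) \<partial>lborel)"
    proof (rule nn_integral_mono_AE)
      show "AE t in lborel. ennreal (indicator {0<..<T0} t * (1 + \<phi> (K t) + \<psi> (u t)))
          \<le> liminf (\<lambda>m. ennreal (indicator {0<..<T0} t * (1 + \<phi> (K t) + \<psi> (q m t))))"
        using u_AE
      proof eventually_elim
        case (elim t)
        then have "(\<lambda>m. \<psi> (q m t)) \<longlonglongrightarrow> \<psi> (u t)"
          by (intro continuous_on_tendsto_compose[OF \<psi>_cont]) auto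
        then have "(\<lambda>m. ennreal (indicator {0<..<T0} t * (1 + \<phi> (K t) + \<psi> (q m t))))
            \<longlonglongrightarrow> ennreal (indicator {0<..<T0} t * (1 + \<phi> (K t) + \<psi> (u t)))"
          by (intro tendsto_ennrealI tendsto_intros)
        then show ?case by (simp add: lim_imp_Liminf)
      qed
    qed
    also have "\<dots> \<le> liminf (\<lambda>m. \<integral>\<^sup>+t. ennreal (indicator {0<..<T0} t * (1 + \<phi> (K t) + \<psi> (q m t))) \<partial>lborel)"
      by (rule nn_integral_liminf) measurable
    also have "\<dots> \<le> liminf (\<lambda>m. ennreal \<mu>0)" by (intro Liminf_mono always_eventually allI step)
    also have "\<dots> = ennreal \<mu>0" by (simp add: Liminf_const)
    finally show ?thesis .
  qed
  have ends: "AE t in lborel. t \<noteq> 0 \<and> t \<noteq> T0"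
    using AE_lborel_singleton[of 0] AE_lborel_singleton[of T0] by eventually_elim simp
  have total': "(\<integral>\<^sup>+t. ennreal (1 + \<phi> (K t) + \<psi> (u t)) * indicator {0..T0} t \<partial>lborel) \<le> ennreal \<mu>0"
  proof -
    have "(\<integral>\<^sup>+t. ennreal (1 + \<phi> (K t) + \<psi> (u t)) * indicator {0..T0} t \<partial>lborel)
        = (\<integral>\<^sup>+t. ennreal (indicator {0<..<T0} t * (1 + \<phi> (K t) + \<psi> (u t))) \<partial>lborel)"
    proof (rule nn_integral_cong_AE)
      show "AE t in lborel. ennreal (1 + \<phi> (K t) + \<psi> (u t)) * indicator {0..T0} t
          = ennreal (indicator {0<..<T0} t * (1 + \<phi> (K t) + \<psi> (u t)))"
        using ends by eventually_elim (auto simp: indicator_def)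
    qed
    with total show ?thesis by simp
  qed
  have up: "integrable (lebesgue_on {0..T0}) (\<lambda>t. \<bar>u t\<bar> powr p)"
  proof (subst integrable_restrict_space)
    \<comment> \<open>The growth hypothesis controls |x|^p only for |x| \<ge> R, and the constant
      covers the rest. That constant is integrable over [0, T0] because the running cost is at least
      1.\<close>
    have bound: "\<bar>x\<bar> powr p \<le> R powr p + 1 / C * \<psi> x" for x
    proof (cases "\<bar>x\<bar> \<ge> R")
      case True
      with growth[of x] pCR have "\<bar>x\<bar> powr p \<le> 1 / C * \<psi> x" by (simp add: field_simps)
      then show ?thesis by (simp add: add_increasing)
    next
      case False
      then have "\<bar>x\<bar> powr p \<le> R powr p" using pCR by (intro powr_mono2) auto
      then show ?thesis using pCR \<psi>(1)[of x] by (simp add: add_increasing2)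
    qed
    have "(\<integral>\<^sup>+t. ennreal (norm (indicator {0..T0} t *\<^sub>R \<bar>u t\<bar> powr p)) \<partial>lborel)
        \<le> (\<integral>\<^sup>+t. ennreal (R powr p + 1 / C) * (ennreal (1 + \<phi> (K t) + \<psi> (u t)) * indicator {0..T0} t) \<partial>lborel)"
    proof (rule nn_integral_mono)
      fix t
      have "\<bar>u t\<bar> powr p \<le> (R powr p + 1 / C) * (1 + \<phi> (K t) + \<psi> (u t))"
      proof -
        have "\<bar>u t\<bar> powr p \<le> R powr p * 1 + 1 / C * \<psi> (u t)" using bound[of "u t"] by simp
        also have "\<dots> \<le> R powr p * (1 + \<phi> (K t) + \<psi> (u t)) + 1 / C * (1 + \<phi> (K t) + \<psi> (u t))"
          using \<phi>(1)[of "K t"] \<psi>(1)[of "u t"] pCR by (intro add_mono mult_left_mono) auto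
        finally show ?thesis by (simp only: distrib_right)
      qed
      then show "ennreal (norm (indicator {0..T0} t *\<^sub>R \<bar>u t\<bar> powr p))
          \<le> ennreal (R powr p + 1 / C) * (ennreal (1 + \<phi> (K t) + \<psi> (u t)) * indicator {0..T0} t)"
        using \<phi>(1)[of "K t"] \<psi>(1)[of "u t"] pCR
        by (cases "t \<in> {0..T0}") (auto simp: ennreal_mult'[symmetric] simp del: ennreal_plus intro!: ennreal_leI)
    qed
    also have "\<dots> = ennreal (R powr p + 1 / C) * (\<integral>\<^sup>+t. ennreal (1 + \<phi> (K t) + \<psi> (u t)) * indicator {0..T0} t \<partial>lborel)"
      by (rule nn_integral_cmult) measurable
    also have "\<dots> \<le> ennreal (R powr p + 1 / C) * ennreal \<mu>0" using total' by (rule mult_left_mono) simp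
    also have "\<dots> < \<infinity>" by (simp add: ennreal_mult_less_top)
    finally have "integrable lborel (\<lambda>t. indicator {0..T0} t *\<^sub>R \<bar>u t\<bar> powr p)"
      by (intro integrableI_bounded) auto
    then show "integrable lebesgue (\<lambda>t. indicat_real {0..T0} t *\<^sub>R \<bar>u t\<bar> powr p)"
      by (subst integrable_completion) auto
  qed auto
  have K': "AE t in lebesgue_on {0..T0}. (K has_real_derivative u t) (at t within {0..T0})"
  proof -
    have "AE t in lborel. (K has_real_derivative u t) (at t within {0..T0})"
      using u_AE by eventually_elim (auto intro: has_field_derivative_at_within)
    then have "AE t in lebesgue. (K has_real_derivative u t) (at t within {0..T0})" by (rule AE_completion)
    then show ?thesis by (subst AE_restrict_space_iff) auto
  qed
  obtain X where X: "admissible p X0 X1 T0 u X" "\<And>t. t \<in> {0..T0} \<Longrightarrow> curvature (X t) = K t"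
    by (rule admissible_of_reaches[OF T0_pos u_meas up AC K' reachK]) blast
  have "cost \<phi> \<psi> T0 u X = (\<integral>\<^sup>+t. ennreal (1 + \<phi> (curvature (X t)) + \<psi> (u t)) * indicator {0..T0} t \<partial>lebesgue)"
    unfolding cost_def by (subst nn_integral_restrict_space) auto
  also have "\<dots> = (\<integral>\<^sup>+t. ennreal (1 + \<phi> (K t) + \<psi> (u t)) * indicator {0..T0} t \<partial>lebesgue)"
    using X(2) by (intro nn_integral_cong) (auto simp: indicator_def)
  also have "\<dots> \<le> ennreal \<mu>0" using total' by (simp add: nn_integral_completion)
  finally show thesis using that X(1) by blast
qed

lemma strictly_convex_imp_convex_on: "strictly_convex f \<Longrightarrow> convex_on UNIV f"
proof (rule convex_onI)
  fix t x y :: real assume "strictly_convex f" "0 < t" "t < 1"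
  then have "f ((1 - t) * x + t * y) < (1 - t) * f x + t * f y" if "x \<noteq> y"
    using that unfolding strictly_convex_def by blast
  then show "f ((1 - t) *\<^sub>R x + t *\<^sub>R y) \<le> (1 - t) * f x + t * f y"
    by (cases "x = y") (auto simp: algebra_simps)
qed auto

theorem proposition3p1:
  fixes \<phi> \<psi> :: "real \<Rightarrow> real" and p C R :: real and X0 X1 :: state
  assumes "\<And>r. \<phi> r \<ge> 0" and "\<And>r. \<psi> r \<ge> 0"
    and "\<And>r. \<phi> (- r) = \<phi> r" and "\<And>r. \<psi> (- r) = \<psi> r"
    and "C2_fun \<phi>" and "C2_fun \<psi>"
    and "mono_on {0..} \<phi>" and "mono_on {0..} \<psi>"
    and "\<phi> 0 = 0" and "\<psi> 0 = 0"
    and "strictly_convex \<psi>" and "deriv (deriv \<psi>) 0 > 0"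
    and "p > 1" and "C > 0" and "R > 0"
    and "\<And>r. \<bar>r\<bar> \<ge> R \<Longrightarrow> \<psi> r \<ge> C * \<bar>r\<bar> powr p"
  shows "\<exists>T u X. admissible p X0 X1 T u X \<and>
    (\<forall>T' u' X'. admissible p X0 X1 T' u' X' \<longrightarrow> cost \<phi> \<psi> T u X \<le> cost \<phi> \<psi> T' u' X')"
proof -
  define m where "m = Inf {cost \<phi> \<psi> T u X |T u X. admissible p X0 X1 T u X}"
  have m_le: "m \<le> cost \<phi> \<psi> T u X" if "admissible p X0 X1 T u X" for T u X
    unfolding m_def using that by (intro Inf_lower) blast
  show ?thesis
  proof (cases "m = top")
    case True
    \<comment> \<open>All competitors have infinite cost here, so any of them is minimal.\<close>
    obtain T u X where "admissible p X0 X1 T u X" using ex_admissible[of p X0 X1] assms(13) by auto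
    then show ?thesis using m_le True by (metis top_greatest top_le)
  next
    case False
    then obtain \<mu>0 where \<mu>0: "m = ennreal \<mu>0" "0 \<le> \<mu>0" by (cases m) auto
    define \<mu> where "\<mu> n = \<mu>0 + 1 / (real n + 1)" for n :: nat
    have \<mu>: "\<mu> \<longlonglongrightarrow> \<mu>0" "0 \<le> \<mu> n" "\<mu> n \<le> \<mu>0 + 1" "\<mu>0 < \<mu> n" for n
      unfolding \<mu>_def[abs_def] using \<mu>0(2) by (real_asymp, auto)
    \<comment> \<open>Time and control must be chosen together for each \<open>n\<close>; the cost
      bound \<mu>(n) lies strictly above the infimum, so a choice exists.\<close>
    define Q where "Q n T v \<longleftrightarrow> 0 < T \<and> integrable lborel v \<and> (\<forall>t. t \<notin> {0..T} \<longrightarrow> v t = 0) \<and>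
        reaches X0 X1 T (\<lambda>t. curvature X0 + primitive v t) \<and>
        (\<integral>\<^sup>+t. ennreal (indicator {0..T} t * (1 + \<phi> (curvature X0 + primitive v t)) + \<psi> (v t)) \<partial>lborel)
          \<le> ennreal (\<mu> n)" for n T v
    have "\<exists>T v. Q n T v" for n
    proof -
      have "m < ennreal (\<mu> n)" using \<mu>0 \<mu>(4)[of n] by (simp add: ennreal_less_iff)
      then obtain T u X where adm: "admissible p X0 X1 T u X" and lt: "cost \<phi> \<psi> T u X < ennreal (\<mu> n)"
        unfolding m_def Inf_less_iff by blast
      obtain v where "integrable lborel v" "\<And>t. t \<notin> {0..T} \<Longrightarrow> v t = 0"
        "reaches X0 X1 T (\<lambda>t. curvature X0 + primitive v t)"
        "cost \<phi> \<psi> T u X = (\<integral>\<^sup>+t. ennreal (indicator {0..T} t *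
            (1 + \<phi> (curvature X0 + primitive v t)) + \<psi> (v t)) \<partial>lborel)"
        by (rule reaches_of_admissible[where \<phi> = \<phi> and \<psi> = \<psi>, OF adm assms(13,10)]) blast
      moreover have "0 < T" using adm by (simp add: admissible_def control_def)
      ultimately show ?thesis using lt unfolding Q_def by (intro exI[of _ T] exI[of _ v]) auto
    qed
    then obtain T v where Q: "\<And>n. Q n (T n) (v n)" by metis
    then have Tv: "\<And>n. 0 < T n" "\<And>n. integrable lborel (v n)"
      "\<And>n t. t \<notin> {0..T n} \<Longrightarrow> v n t = 0"
      "\<And>n. reaches X0 X1 (T n) (\<lambda>t. curvature X0 + primitive (v n) t)"
      "\<And>n. (\<integral>\<^sup>+t. ennreal (indicator {0..T n} t * (1 + \<phi> (curvature X0 + primitive (v n) t)) + \<psi> (v n t)) \<partial>lborel)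
          \<le> ennreal (\<mu> n)"
      unfolding Q_def by blast+
    have \<phi>_cont: "continuous_on UNIV \<phi>" and \<psi>_diff: "\<And>r. \<psi> differentiable at r"
      using assms(5,6) unfolding C2_fun_def
      by (meson continuous_at_imp_continuous_on differentiable_imp_continuous_within, blast)
    obtain T0 u X where X: "admissible p X0 X1 T0 u X" "cost \<phi> \<psi> T0 u X \<le> m"
      unfolding \<mu>0(1) by (rule minimizing_sequence_limit[OF assms(1) \<phi>_cont assms(2,4)
            strictly_convex_imp_convex_on[OF assms(11)] \<psi>_diff assms(10,16,13,14,15) Tv \<mu>(1-3)]) blast+
    have "cost \<phi> \<psi> T0 u X \<le> cost \<phi> \<psi> T' u' X'" if "admissible p X0 X1 T' u' X'" for T' u' X'
      using X(2) m_le[OF that] by (rule order_trans)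
    with X(1) show ?thesis by blast
  qed
qed

end
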